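(* Let $b$ be a power of three. With probability one: (1) for every point $\xi\in K$, $v^{\bullet}_b(\xi)\geq 0$; and (2) for every real number $v\geq 0$, $\dim_H(\mathcal{V}^{\bullet}_b(v)\cap K)=\frac{\kappa}{v+1}$.
   Context: $\mathbb{T}=\mathbb{R}/\mathbb{Z}$ with quotient distance $d$. $K$ is the image in $\mathbb{T}$ of the middle-third Cantor set, $\kappa=\log2/\log3$. For $j\ge1$, let $\mathcal{K}^j$ be the set of integers $k\in\{0,\dots,b^j-1\}$ with $\gcd(k,b^j)=1$, and $\mathcal{K}^j_K$ the set of $k\in\mathcal{K}^j$ with $kb^{-j}\in K$. Let $(Y_{j,k})_{j\ge1,k\in\mathcal{K}^j}$ be independent random points of $\mathbb{T}$, with $Y_{j,k}$ distributed according to the normalized $\kappa$-dimensional Hausdorff measure on $K$ if $k\in\mathcal{K}^j_K$ and according to Lebesgue measure on $\mathbb{T}$ otherwise. For $v\in\mathbb{R}$ let $\mathcal{F}_b(v)=\{\xi\in\mathbb{T}: d(\xi,Y_{j,k})<b^{-(v+1)j}\text{ for infinitely many pairs }(j,k)\text{ with }j\ge1,k\in\mathcal{K}^j\}$, $v^{\bullet}_b(\xi)=\sup\{v\in\mathbb{R}:\xi\in\mathcal{F}_b(v)\}$, and $\mathcal{V}^{\bullet}_b(v)=\{\xi\in\mathbb{T}: v^{\bullet}_b(\xi)\ge v\}$. $\dim_H$ is Hausdorff dimension. *)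

theory Defs
  imports "HOL-Probability.Probability"
begin

definition torus :: "real set" where
  "torus = {0..<1}"

text \<open>Quotient distance on R/Z (also makes sense for arbitrary reals, via reduction mod 1).\<close>
definition tdist :: "real \<Rightarrow> real \<Rightarrow> real" where
  "tdist x y = min (frac (x - y)) (1 - frac (x - y))"

definition cantor_set :: "real set" where
  "cantor_set = {x. \<exists>a::nat \<Rightarrow> real. (\<forall>n. a n \<in> {0, 2}) \<and> x = (\<Sum>n. a n / 3 ^ (n + 1))}"

definition cantorK :: "real set" where
  "cantorK = frac ` cantor_set"

definition kappa :: real where
  "kappa = ln 2 / ln 3"

definition tdiam :: "real set \<Rightarrow> real" where
  "tdiam U = (if U = {} then 0 else Sup {tdist x y | x y. x \<in> U \<and> y \<in> U})"

definition hterm :: "real \<Rightarrow> real set \<Rightarrow> real" where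
  "hterm s U = (if U = {} then 0 else if s = 0 then 1 else tdiam U powr s)"

definition hausdorff_delta :: "real \<Rightarrow> real \<Rightarrow> real set \<Rightarrow> ennreal" where
  "hausdorff_delta s \<delta> A =
     (INF U \<in> {U :: nat \<Rightarrow> real set. A \<subseteq> \<Union>(range U) \<and> (\<forall>i. tdiam (U i) \<le> \<delta>)}.
        \<Sum>i. ennreal (hterm s (U i)))"

definition hausdorff :: "real \<Rightarrow> real set \<Rightarrow> ennreal" where
  "hausdorff s A = (SUP \<delta> \<in> {0<..}. hausdorff_delta s \<delta> A)"

definition hdim :: "real set \<Rightarrow> real" where
  "hdim A = Inf {s. 0 \<le> s \<and> hausdorff s A = 0}"

definition cantor_measure :: "real measure" where
  "cantor_measure = measure_of UNIV (sets (borel :: real measure))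
      (\<lambda>A. hausdorff kappa (A \<inter> cantorK) / hausdorff kappa cantorK)"

definition torus_lebesgue :: "real measure" where
  "torus_lebesgue = density lborel (indicator {0..<1::real})"

definition Kset :: "nat \<Rightarrow> nat \<Rightarrow> nat set" where
  "Kset b j = {k. k < b ^ j \<and> coprime k (b ^ j)}"

definition KsetK :: "nat \<Rightarrow> nat \<Rightarrow> nat set" where
  "KsetK b j = {k \<in> Kset b j. real k / real b ^ j \<in> cantorK}"

definition Fb :: "nat \<Rightarrow> (nat \<times> nat \<Rightarrow> 'a \<Rightarrow> real) \<Rightarrow> 'a \<Rightarrow> real \<Rightarrow> real set" where
  "Fb b Y \<omega> v = {\<xi> \<in> torus. infinite {(j, k). j \<ge> 1 \<and> k \<in> Kset b j \<and>
        tdist \<xi> (Y (j, k) \<omega>) < real b powr (- (v + 1) * real j)}}"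

definition vbullet :: "nat \<Rightarrow> (nat \<times> nat \<Rightarrow> 'a \<Rightarrow> real) \<Rightarrow> 'a \<Rightarrow> real \<Rightarrow> ereal" where
  "vbullet b Y \<omega> \<xi> = Sup {ereal v | v. \<xi> \<in> Fb b Y \<omega> v}"

definition Vbullet :: "nat \<Rightarrow> (nat \<times> nat \<Rightarrow> 'a \<Rightarrow> real) \<Rightarrow> 'a \<Rightarrow> real \<Rightarrow> real set" where
  "Vbullet b Y \<omega> v = {\<xi> \<in> torus. ereal v \<le> vbullet b Y \<omega> \<xi>}"

end

theory Submission
  imports Defs "HOL-Real_Asymp.Real_Asymp"
begin

text \<open>
  Write \<open>n = m j\<close>. Among the points of generation \<open>j\<close> about \<open>2 ^ n\<close> follow the Cantor measure,
  and a cylinder of level \<open>l\<close> has mass at least \<open>2 ^ - l\<close>. If \<open>l\<close> is a little below \<open>n\<close>, the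
  probability that some cylinder of level \<open>l\<close> is missed is summable, so almost surely all these
  cylinders are hit for all large \<open>j\<close>; this is (1).

  For the upper bound in (2), a Lebesgue point of generation \<open>j\<close> is within \<open>r = 3 powr (- (v + 1) n)\<close>
  of the Cantor set with probability \<open>O(r powr (1 - kappa))\<close>. Hence the expected sum of the
  \<open>s\<close>-th powers of the diameters of the balls that meet the Cantor set is finite as soon as
  \<open>s (v + 1) > kappa\<close> and \<open>(v + 1) (1 - kappa + s) > 1\<close>; near a given nonnegative \<open>v\<close> the first
  condition is the binding one.

  For the lower bound, fix sparse generations and prescribe the digits between \<open>l\<close> and
  \<open>(v + 1) n\<close> to be those of a random point in the cylinder given by the first \<open>l\<close> digits. All the
  points so obtained are limsup points, and the free digits have lower density close to
  \<open>1 / (v + 1)\<close>. The map that keeps only the free digits is Hoelder with about this exponent and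
  maps onto the Cantor set.
\<close>

section \<open>Digit coding of the Cantor set\<close>

definition cval :: "(nat \<Rightarrow> bool) \<Rightarrow> real" where
  "cval a = (\<Sum>n. 2 * of_bool (a n) / 3 ^ (n + 1))"

text \<open>\<open>cpre a n / 3 ^ n\<close> is the left end point of the triadic interval of level
  \<open>n\<close> that contains \<open>cval a\<close>. As natural numbers, prefixes can name
  cylinders and be compared with the fractions \<open>k / b ^ j\<close>.\<close>

primrec cpre :: "(nat \<Rightarrow> bool) \<Rightarrow> nat \<Rightarrow> nat" where
  "cpre a 0 = 0"
| "cpre a (Suc n) = 3 * cpre a n + 2 * of_bool (a n)"

lemma sums_two_thirds: "(\<lambda>n. 2 / 3 ^ (n + 1) :: real) sums 1"
  using sums_mult[OF geometric_sums[of "1/3::real"], of "2/3"] by (simp add: power_divide)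

lemma summable_cval: "summable (\<lambda>n. 2 * of_bool (a n) / 3 ^ (n + 1) :: real)"
  by (rule summable_comparison_test'[OF sums_summable[OF sums_two_thirds]]) auto

lemma cval_nonneg: "0 \<le> cval a"
  unfolding cval_def by (intro suminf_nonneg summable_cval) auto

lemma cval_le_1: "cval a \<le> 1"
proof -
  have "cval a \<le> (\<Sum>n. 2 / 3 ^ (n + 1) :: real)"
    unfolding cval_def by (intro suminf_le summable_cval sums_summable[OF sums_two_thirds]) auto
  then show ?thesis using sums_unique[OF sums_two_thirds] by simp
qed

lemma cval_Suc: "cval a = (2 * of_bool (a 0) + cval (\<lambda>i. a (Suc i))) / 3"
proof -
  have "(\<Sum>n. 2 * of_bool (a (Suc n)) / 3 ^ (n + 2)) = cval (\<lambda>i. a (Suc i)) / 3"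
    unfolding cval_def by (subst suminf_divide[symmetric, OF summable_cval]) simp
  then show ?thesis
    using suminf_split_head[OF summable_cval[of a]] unfolding cval_def by simp
qed

text \<open>Self-similarity: an integer prefix plus a tail in \<open>[0, 1]\<close>, rescaled. The
  metric estimates below compare prefixes and tails in this form.\<close>

lemma cval_cpre: "cval a = (real (cpre a n) + cval (\<lambda>i. a (i + n))) / 3 ^ n"
proof (induction n)
  case (Suc n)
  then show ?case using cval_Suc[of "\<lambda>i. a (i + n)"] by (simp add: field_simps)
qed simp

lemma cpre_eq_iff: "cpre a n = cpre a' n \<longleftrightarrow> (\<forall>i<n. a i = a' i)"
proof (induction n)
  case (Suc n)
  have "3 * x + 2 * of_bool p = 3 * y + 2 * of_bool q \<longleftrightarrow> x = y \<and> p = q" for x y :: nat and p q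
    by (cases p; cases q; simp; presburger)
  then show ?case using Suc by (auto simp: less_Suc_eq)
qed simp

text \<open>Equal prefixes cancel in \<open>cval_cpre\<close>, leaving the difference of two tails
  in \<open>[0, 1]\<close>.\<close>

lemma cval_agree:
  assumes "\<And>i. i < n \<Longrightarrow> a i = a' i"
  shows "\<bar>cval a - cval a'\<bar> \<le> 1 / 3 ^ n"
proof -
  let ?s = "\<lambda>a i. a (i + n) :: bool"
  have "cpre a n = cpre a' n" using assms by (simp add: cpre_eq_iff)
  then have "cval a - cval a' = (cval (?s a) - cval (?s a')) / 3 ^ n"
    using cval_cpre[of a n] cval_cpre[of a' n] by (simp add: field_simps)
  moreover have "\<bar>cval (?s a) - cval (?s a')\<bar> \<le> 1"
    using cval_nonneg[of "?s a"] cval_le_1[of "?s a"] cval_nonneg[of "?s a'"] cval_le_1[of "?s a'"]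
    by linarith
  ultimately show ?thesis by (simp add: divide_right_mono)
qed

text \<open>The prefixes of length \<open>Suc n\<close> differ by exactly 2 and the tails by at most
  1: this is the gap left by a removed middle third.\<close>

lemma cval_separated:
  assumes "\<And>i. i < n \<Longrightarrow> a i = a' i" "a n \<noteq> a' n"
  shows "1 / 3 ^ Suc n \<le> \<bar>cval a - cval a'\<bar>"
proof -
  let ?s = "\<lambda>a i. a (i + Suc n) :: bool"
  have eq: "cpre a n = cpre a' n" using assms by (simp add: cpre_eq_iff)
  have "cval a - cval a' = (real (cpre a (Suc n)) - real (cpre a' (Suc n)) + (cval (?s a) - cval (?s a'))) / 3 ^ Suc n"
    unfolding cval_cpre[of a "Suc n"] cval_cpre[of a' "Suc n"] diff_divide_distrib[symmetric]
    by (simp only: algebra_simps)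
  then have "\<bar>cval a - cval a'\<bar> = \<bar>real (cpre a (Suc n)) - real (cpre a' (Suc n)) + (cval (?s a) - cval (?s a'))\<bar> / 3 ^ Suc n"
    by (simp only: abs_divide power_abs abs_numeral)
  moreover have "1 \<le> \<bar>real (cpre a (Suc n)) - real (cpre a' (Suc n)) + (cval (?s a) - cval (?s a'))\<bar>"
    using assms(2) eq
      cval_nonneg[of "?s a"] cval_le_1[of "?s a"] cval_nonneg[of "?s a'"] cval_le_1[of "?s a'"]
    by (cases "a n"; cases "a' n"; simp)
  ultimately show ?thesis by (simp add: divide_right_mono)
qed

lemma first_difference:
  assumes "a \<noteq> (a' :: nat \<Rightarrow> 'b)"
  obtains n where "a n \<noteq> a' n" "\<And>i. i < n \<Longrightarrow> a i = a' i"
proof -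
  have "\<exists>n. a n \<noteq> a' n" using assms by auto
  then show ?thesis using that exists_least_iff[of "\<lambda>n. a n \<noteq> a' n"] by auto
qed

lemma inj_cval: "inj cval"
proof (rule injI, rule ccontr)
  fix a a' assume eq: "cval a = cval a'" and "a \<noteq> a'"
  from this(2) obtain n where "a n \<noteq> a' n" "\<And>i. i < n \<Longrightarrow> a i = a' i"
    by (rule first_difference[of a a']) auto
  then have "1 / 3 ^ Suc n \<le> \<bar>cval a - cval a'\<bar>" by (intro cval_separated)
  moreover have "0 < 1 / (3 :: real) ^ Suc n" by simp
  ultimately show False using eq by linarith
qed

lemma cantor_set_eq: "cantor_set = range cval"
proof (intro equalityI subsetI)
  fix x assume "x \<in> cantor_set"
  then obtain c :: "nat \<Rightarrow> real" where c: "\<forall>n. c n \<in> {0, 2}" "x = (\<Sum>n. c n / 3 ^ (n + 1))"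
    unfolding cantor_set_def by auto
  have "x = cval (\<lambda>n. c n = 2)" unfolding cval_def c(2)
    by (rule suminf_cong) (use c(1) in auto)
  then show "x \<in> range cval" by auto
next
  fix x assume "x \<in> range cval"
  then obtain a where "x = cval a" by auto
  then show "x \<in> cantor_set" unfolding cantor_set_def cval_def
    by (intro CollectI exI[of _ "\<lambda>n. 2 * of_bool (a n)"]) auto
qed

section \<open>Closedness of the Cantor set through its finite stages\<close>

definition cantor_step :: "real \<Rightarrow> real" where
  "cantor_step x = (if x \<le> 1 / 2 then 3 * x else 3 * x - 2)"

definition cantor_iter :: "nat \<Rightarrow> real set" where
  "cantor_iter n = ((\<lambda>S. (\<lambda>x. x / 3) ` S \<union> (\<lambda>x. (2 + x) / 3) ` S) ^^ n) {0..1}"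

lemma cantor_iter_0: "cantor_iter 0 = {0..1}"
  and cantor_iter_Suc: "cantor_iter (Suc n) = (\<lambda>x. x / 3) ` cantor_iter n \<union> (\<lambda>x. (2 + x) / 3) ` cantor_iter n"
  by (simp_all add: cantor_iter_def)

lemma compact_cantor_iter: "compact (cantor_iter n)"
  by (induction n)
    (auto simp: cantor_iter_0 cantor_iter_Suc intro!: compact_Un compact_continuous_image continuous_intros)

lemma cantor_iter_bounds: "cantor_iter n \<subseteq> {0..1}"
  by (induction n) (auto simp: cantor_iter_0 cantor_iter_Suc)

text \<open>\<open>cantor_step\<close> inverts both contractions: \<open>y / 3 \<le> 1 / 3\<close>
  and \<open>(2 + y) / 3 \<ge> 2 / 3\<close>, so the threshold 1/2 tells the branches apart.\<close>

lemma cantor_step_iter: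
  assumes "x \<in> cantor_iter (Suc n)"
  shows "cantor_step x \<in> cantor_iter n"
proof -
  obtain y where y: "y \<in> cantor_iter n" "x = y / 3 \<or> x = (2 + y) / 3"
    using assms by (auto simp: cantor_iter_Suc)
  then have "0 \<le> y" "y \<le> 1" using cantor_iter_bounds[of n] by auto
  with y have "cantor_step x = y" by (auto simp: cantor_step_def)
  with y show ?thesis by simp
qed

text \<open>For a point of all stages, the orbit under \<open>cantor_step\<close> stays in
  \<open>[0, 1]\<close>, and the ternary digits are read off this orbit. The equality yields
  closedness and hence measurability of cylinders.\<close>

lemma cantor_set_eq_Inter: "cantor_set = (\<Inter>n. cantor_iter n)"
proof (intro equalityI subsetI)
  have "cval a \<in> cantor_iter n" for a n
  proof (induction n arbitrary: a)
    case 0 then show ?case by (simp add: cantor_iter_0 cval_nonneg cval_le_1)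
  next
    case (Suc n)
    then show ?case using cval_Suc[of a] Suc[of "\<lambda>i. a (Suc i)"]
      by (cases "a 0") (auto simp: cantor_iter_Suc)
  qed
  then show "x \<in> (\<Inter>n. cantor_iter n)" if "x \<in> cantor_set" for x
    using that by (auto simp: cantor_set_eq)
next
  fix x assume x: "x \<in> (\<Inter>n. cantor_iter n)"
  define y where "y n = (cantor_step ^^ n) x" for n
  define a where "a n \<longleftrightarrow> y n > 1 / 2" for n
  have "y n \<in> cantor_iter k" for n k
  proof (induction n arbitrary: k)
    case 0 then show ?case using x by (simp add: y_def)
  next
    case (Suc n) then show ?case using cantor_step_iter[of "y n" k] by (simp add: y_def)
  qed
  then have y01: "0 \<le> y n" "y n \<le> 1" for n using cantor_iter_bounds[of 0] by fastforce+
  \<comment> \<open>After \<open>n\<close> steps \<open>x\<close> has the same prefix as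
    \<open>cval a\<close> and again a tail in \<open>[0, 1]\<close>, so the two differ by at most
    \<open>1 / 3 ^ n\<close>.\<close>
  have xy: "x = (real (cpre a n) + y n) / 3 ^ n" for n
  proof (induction n)
    case 0 then show ?case by (simp add: y_def)
  next
    case (Suc n)
    have "y (Suc n) = 3 * y n - 2 * of_bool (a n)"
      by (auto simp: y_def cantor_step_def a_def)
    then show ?case using Suc by (simp add: field_simps)
  qed
  have "\<bar>x - cval a\<bar> \<le> (1 / 3) ^ n" for n
  proof -
    have "x - cval a = (y n - cval (\<lambda>i. a (i + n))) / 3 ^ n"
      by (subst xy[of n], subst cval_cpre[of a n]) (simp add: field_simps)
    moreover have "\<bar>y n - cval (\<lambda>i. a (i + n))\<bar> \<le> 1"
      using y01[of n] cval_nonneg[of "\<lambda>i. a (i + n)"] cval_le_1[of "\<lambda>i. a (i + n)"] by linarith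
    ultimately show ?thesis by (simp add: divide_right_mono power_divide)
  qed
  then have "\<bar>x - cval a\<bar> \<le> 0"
    by (intro LIMSEQ_le_const[OF LIMSEQ_realpow_zero[of "1/3"]]) auto
  then show "x \<in> cantor_set" by (auto simp: cantor_set_eq)
qed

lemma closed_cantor_set: "closed cantor_set"
  unfolding cantor_set_eq_Inter by (intro closed_INT ballI compact_imp_closed compact_cantor_iter)

lemma cantor_bounds: "x \<in> cantor_set \<Longrightarrow> 0 \<le> x \<and> x \<le> 1"
  by (auto simp: cantor_set_eq cval_nonneg cval_le_1)

section \<open>Hausdorff measures on the circle\<close>

lemma tdist_le: "tdist x y \<le> \<bar>x - y - of_int k\<bar>"
proof (cases "k \<le> \<lfloor>x - y\<rfloor>")
  case True
  then have "real_of_int k \<le> of_int \<lfloor>x - y\<rfloor>" by simp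
  then show ?thesis unfolding tdist_def frac_def by linarith
next
  case False
  then have "real_of_int (\<lfloor>x - y\<rfloor> + 1) \<le> of_int k" by linarith
  then show ?thesis unfolding tdist_def frac_def by simp
qed

text \<open>With \<open>tdist_le\<close> this makes \<open>tdist x y\<close> the minimum of
  \<open>|x - y - k|\<close> over the integers; metric facts then follow by a choice of
  \<open>k\<close>.\<close>

lemma tdist_attained: obtains k where "tdist x y = \<bar>x - y - of_int k\<bar>"
proof (cases "frac (x - y) \<le> 1 - frac (x - y)")
  case True
  then have "tdist x y = \<bar>x - y - of_int \<lfloor>x - y\<rfloor>\<bar>"
    using frac_ge_0[of "x - y"] unfolding tdist_def frac_def by linarith
  then show ?thesis by (rule that)
next
  case False
  then have "tdist x y = \<bar>x - y - of_int (\<lfloor>x - y\<rfloor> + 1)\<bar>"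
    using frac_lt_1[of "x - y"] unfolding tdist_def frac_def by simp
  then show ?thesis by (rule that)
qed

lemma tdist_nonneg: "0 \<le> tdist x y"
  using frac_ge_0[of "x - y"] frac_lt_1[of "x - y"] unfolding tdist_def by linarith

lemma tdist_le_half: "tdist x y \<le> 1 / 2"
  unfolding tdist_def by linarith

lemma tdist_le_abs: "tdist x y \<le> \<bar>x - y\<bar>"
  using tdist_le[of x y 0] by simp

text \<open>Up to half the circumference, a nonzero integer shift cannot bring the points
  closer.\<close>

lemma tdist_eq_abs:
  assumes "\<bar>x - y\<bar> \<le> 1 / 2"
  shows "tdist x y = \<bar>x - y\<bar>"
proof -
  obtain k where k: "tdist x y = \<bar>x - y - of_int k\<bar>" by (rule tdist_attained)
  have "\<bar>x - y\<bar> \<le> \<bar>x - y - of_int k\<bar>"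
  proof (cases "k = 0")
    case False
    then have "1 \<le> \<bar>k\<bar>" by linarith
    then have "1 \<le> \<bar>real_of_int k\<bar>" by linarith
    then show ?thesis using assms by linarith
  qed simp
  then show ?thesis using k tdist_le_abs[of x y] by linarith
qed

lemma tdist_commute: "tdist x y = tdist y x"
proof -
  have "tdist x y \<le> tdist y x" for x y
  proof -
    obtain k where "tdist y x = \<bar>y - x - of_int k\<bar>" by (rule tdist_attained)
    then show ?thesis using tdist_le[of x y "- k"] by simp
  qed
  then show ?thesis by (meson antisym)
qed

lemma tdist_triangle: "tdist x z \<le> tdist x y + tdist y z"
proof -
  obtain k where k: "tdist x y = \<bar>x - y - of_int k\<bar>" by (rule tdist_attained)
  obtain l where l: "tdist y z = \<bar>y - z - of_int l\<bar>" by (rule tdist_attained)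
  show ?thesis using tdist_le[of x z "k + l"] k l by simp
qed

lemma tdist_frac_left: "tdist (frac x) y = tdist x y"
proof -
  have "frac x - y = (x - y) - of_int \<lfloor>x\<rfloor>" by (simp add: frac_def)
  then have "frac (frac x - y) = frac (x - y)" by (simp only: frac_def floor_diff_of_int of_int_diff)
  then show ?thesis by (simp add: tdist_def)
qed

lemma tdist_frac: "tdist (frac x) (frac y) = tdist x y"
  by (metis tdist_frac_left tdist_commute)

section \<open>Diameters on the circle and terms of covering sums\<close>

lemma tdist_le_tdiam:
  assumes "x \<in> U" "y \<in> U"
  shows "tdist x y \<le> tdiam U"
proof -
  have "bdd_above {tdist x y | x y. x \<in> U \<and> y \<in> U}"
    using tdist_le_half by (intro bdd_aboveI[of _ "1 / 2"]) blast
  then show ?thesis using assms unfolding tdiam_def by (auto intro!: cSup_upper)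
qed

lemma tdiam_le:
  assumes "0 \<le> c" "\<And>x y. x \<in> U \<Longrightarrow> y \<in> U \<Longrightarrow> tdist x y \<le> c"
  shows "tdiam U \<le> c"
proof (cases "U = {}")
  case False
  then have "{tdist x y | x y. x \<in> U \<and> y \<in> U} \<noteq> {}" by blast
  then have "Sup {tdist x y | x y. x \<in> U \<and> y \<in> U} \<le> c"
    by (rule cSup_least) (use assms in auto)
  then show ?thesis using False by (simp add: tdiam_def)
qed (use assms in \<open>simp add: tdiam_def\<close>)

lemma tdiam_nonneg: "0 \<le> tdiam U"
proof (cases "U = {}")
  case False
  then obtain x where "x \<in> U" by auto
  then show ?thesis using tdist_le_tdiam[of x U x] tdist_nonneg[of x x] by simp
qed (simp add: tdiam_def)

lemma tdiam_le_half: "tdiam U \<le> 1 / 2"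
  by (intro tdiam_le tdist_le_half) simp

lemma hterm_nonneg: "0 \<le> hterm s U"
  by (simp add: hterm_def)

lemma hterm_le_powr: "0 < s \<Longrightarrow> hterm s U \<le> tdiam U powr s"
  by (simp add: hterm_def)

text \<open>Diameters are at most 1/2, so larger exponents give smaller powers. At exponent 0 the
  value 1 for nonempty sets dominates, even when the diameter is 0.\<close>

lemma hterm_antimono:
  assumes "0 \<le> s" "s \<le> t"
  shows "hterm t U \<le> hterm s U"
  using assms tdiam_nonneg[of U] tdiam_le_half[of U]
  by (auto simp: hterm_def intro!: powr_mono' powr_le1)

section \<open>Hausdorff measure: monotonicity, subadditivity, images, limsup sets\<close>

lemma hausdorff_delta_le:
  assumes "A \<subseteq> \<Union>(range U)" "\<And>i. tdiam (U i) \<le> \<delta>"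
  shows "hausdorff_delta s \<delta> A \<le> (\<Sum>i. ennreal (hterm s (U i)))"
  unfolding hausdorff_delta_def by (intro INF_lower) (use assms in auto)

lemma hausdorff_delta_greatest:
  assumes "\<And>U. A \<subseteq> \<Union>(range U) \<Longrightarrow> (\<And>i. tdiam (U i) \<le> \<delta>) \<Longrightarrow> c \<le> (\<Sum>i. ennreal (hterm s (U i)))"
  shows "c \<le> hausdorff_delta s \<delta> A"
  unfolding hausdorff_delta_def by (intro INF_greatest) (use assms in auto)

lemma hausdorff_delta_le_hausdorff: "0 < \<delta> \<Longrightarrow> hausdorff_delta s \<delta> A \<le> hausdorff s A"
  unfolding hausdorff_def by (intro SUP_upper) auto

lemma hausdorff_least: "(\<And>\<delta>. 0 < \<delta> \<Longrightarrow> hausdorff_delta s \<delta> A \<le> c) \<Longrightarrow> hausdorff s A \<le> c"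
  unfolding hausdorff_def by (intro SUP_least) auto

lemma hausdorff_mono:
  assumes "A \<subseteq> B"
  shows "hausdorff s A \<le> hausdorff s B"
proof (rule hausdorff_least)
  fix \<delta> :: real assume "0 < \<delta>"
  have "hausdorff_delta s \<delta> A \<le> hausdorff_delta s \<delta> B"
    by (intro hausdorff_delta_greatest hausdorff_delta_le) (use assms in auto)
  with \<open>0 < \<delta>\<close> show "hausdorff_delta s \<delta> A \<le> hausdorff s B"
    using hausdorff_delta_le_hausdorff order_trans by blast
qed

lemma hausdorff_antimono:
  assumes "0 \<le> s" "s \<le> t"
  shows "hausdorff t A \<le> hausdorff s A"
proof (rule hausdorff_least)
  fix \<delta> :: real assume "0 < \<delta>"
  have "hausdorff_delta t \<delta> A \<le> hausdorff_delta s \<delta> A"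
  proof (rule hausdorff_delta_greatest)
    fix U :: "nat \<Rightarrow> real set" assume "A \<subseteq> \<Union>(range U)" "\<And>i. tdiam (U i) \<le> \<delta>"
    then have "hausdorff_delta t \<delta> A \<le> (\<Sum>i. ennreal (hterm t (U i)))" by (rule hausdorff_delta_le)
    also have "\<dots> \<le> (\<Sum>i. ennreal (hterm s (U i)))"
      by (intro suminf_le ennreal_leI hterm_antimono assms) auto
    finally show "hausdorff_delta t \<delta> A \<le> (\<Sum>i. ennreal (hterm s (U i)))" .
  qed
  with \<open>0 < \<delta>\<close> show "hausdorff_delta t \<delta> A \<le> hausdorff s A"
    using hausdorff_delta_le_hausdorff order_trans by blast
qed

lemma hausdorff_empty: "hausdorff s {} = 0"
proof -
  have "hausdorff_delta s \<delta> {} \<le> (\<Sum>i::nat. ennreal (hterm s {}))" if "0 < \<delta>" for \<delta>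
    by (rule hausdorff_delta_le) (use that in \<open>auto simp: tdiam_def\<close>)
  then have "hausdorff s {} \<le> 0" by (intro hausdorff_least) (simp add: hterm_def)
  then show ?thesis by simp
qed

text \<open>The first \<open>2 * N\<close> interleaved terms are the first \<open>N\<close> terms of
  each series.\<close>

lemma suminf_interleave_le:
  fixes f g :: "nat \<Rightarrow> ennreal"
  shows "(\<Sum>n. if even n then f (n div 2) else g (n div 2)) \<le> (\<Sum>n. f n) + (\<Sum>n. g n)"
proof (rule suminf_le_const)
  let ?h = "\<lambda>n. if even n then f (n div 2) else g (n div 2)"
  fix n
  have "sum ?h {..<2 * N} = sum f {..<N} + sum g {..<N}" for N
    by (induction N) (simp_all add: ac_simps)
  moreover have "sum ?h {..<n} \<le> sum ?h {..<2 * n}" by (intro sum_mono2) auto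
  ultimately have "sum ?h {..<n} \<le> sum f {..<n} + sum g {..<n}" by simp
  also have "\<dots> \<le> suminf f + suminf g" by (intro add_mono sum_le_suminf) auto
  finally show "sum ?h {..<n} \<le> suminf f + suminf g" .
qed simp

text \<open>Serves to pass to the infimum over one family of covers at a time, in place of nearly
  optimal covers. Cancelling \<open>c\<close> requires it to be finite, hence the case
  split.\<close>

lemma ennreal_le_add_INF:
  fixes f :: "'i \<Rightarrow> ennreal"
  assumes "\<And>i. i \<in> I \<Longrightarrow> x \<le> c + f i"
  shows "x \<le> c + (INF i\<in>I. f i)"
proof (cases "c = top")
  case False
  then have "x - c \<le> (INF i\<in>I. f i)"
    using assms by (intro INF_greatest) (simp add: ennreal_minus_le_iff)
  with False show ?thesis by (simp add: ennreal_minus_le_iff)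
qed simp

text \<open>Two covers of mesh \<open>\<delta>\<close> interleave to one sequence that covers the
  union with the same mesh.\<close>

lemma hausdorff_Un: "hausdorff s (A \<union> B) \<le> hausdorff s A + hausdorff s B"
proof (rule hausdorff_least)
  fix \<delta> :: real assume \<delta>: "0 < \<delta>"
  have *: "hausdorff_delta s \<delta> (A \<union> B) \<le> (\<Sum>i. ennreal (hterm s (U i))) + (\<Sum>i. ennreal (hterm s (V i)))"
    if "A \<subseteq> \<Union>(range U)" "\<And>i. tdiam (U i) \<le> \<delta>" "B \<subseteq> \<Union>(range V)" "\<And>i. tdiam (V i) \<le> \<delta>" for U V
  proof -
    define W where "W n = (if even n then U (n div 2) else V (n div 2))" for n
    have "U i = W (2 * i)" "V i = W (2 * i + 1)" for i by (simp_all add: W_def)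
    then have "\<Union>(range U) \<union> \<Union>(range V) \<subseteq> \<Union>(range W)" by auto
    with that have "A \<union> B \<subseteq> \<Union>(range W)" by auto
    moreover have "tdiam (W i) \<le> \<delta>" for i using that by (simp add: W_def)
    ultimately have "hausdorff_delta s \<delta> (A \<union> B) \<le> (\<Sum>i. ennreal (hterm s (W i)))"
      by (rule hausdorff_delta_le)
    also have "\<dots> = (\<Sum>n. if even n then ennreal (hterm s (U (n div 2))) else ennreal (hterm s (V (n div 2))))"
      by (intro suminf_cong) (simp add: W_def)
    also note suminf_interleave_le
    finally show ?thesis .
  qed
  have "hausdorff_delta s \<delta> (A \<union> B) \<le> hausdorff_delta s \<delta> A + hausdorff_delta s \<delta> B"
    unfolding hausdorff_delta_def[of s \<delta> B]
  proof (rule ennreal_le_add_INF)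
    fix V assume V: "V \<in> {V :: nat \<Rightarrow> real set. B \<subseteq> \<Union>(range V) \<and> (\<forall>i. tdiam (V i) \<le> \<delta>)}"
    show "hausdorff_delta s \<delta> (A \<union> B) \<le> hausdorff_delta s \<delta> A + (\<Sum>i. ennreal (hterm s (V i)))"
      unfolding hausdorff_delta_def[of s \<delta> A] add.commute[of _ "\<Sum>i. ennreal (hterm s (V i))"]
    proof (rule ennreal_le_add_INF)
      fix U assume U: "U \<in> {U :: nat \<Rightarrow> real set. A \<subseteq> \<Union>(range U) \<and> (\<forall>i. tdiam (U i) \<le> \<delta>)}"
      show "hausdorff_delta s \<delta> (A \<union> B) \<le> (\<Sum>i. ennreal (hterm s (V i))) + (\<Sum>i. ennreal (hterm s (U i)))"
        using *[of U V] U V by (simp add: add.commute)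
    qed
  qed
  also have "\<dots> \<le> hausdorff s A + hausdorff s B"
    by (intro add_mono hausdorff_delta_le_hausdorff \<delta>)
  finally show "hausdorff_delta s \<delta> (A \<union> B) \<le> hausdorff s A + hausdorff s B" .
qed

lemma hausdorff_UN:
  assumes "finite I"
  shows "hausdorff s (\<Union>i\<in>I. A i) \<le> (\<Sum>i\<in>I. hausdorff s (A i))"
  using assms
proof (induction I)
  case (insert i I)
  then show ?case using hausdorff_Un[of s "A i" "\<Union>i\<in>I. A i"] by (simp add: order_trans[OF _ add_left_mono])
qed (simp add: hausdorff_empty)

text \<open>A covering set of diameter \<open>d\<close> has an image of diameter at most
  \<open>C * d powr \<alpha>\<close>, whose power \<open>s\<close> is
  \<open>C powr s * d powr (\<alpha> * s)\<close>.\<close>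

lemma hausdorff_Hoelder_image:
  assumes "0 < s" "0 < C" "0 < \<alpha>"
    and g: "\<And>x y. x \<in> A \<Longrightarrow> y \<in> A \<Longrightarrow> tdist (g x) (g y) \<le> C * tdist x y powr \<alpha>"
  shows "hausdorff s (g ` A) \<le> ennreal (C powr s) * hausdorff (\<alpha> * s) A"
proof (rule hausdorff_least)
  fix \<delta> :: real assume \<delta>: "0 < \<delta>"
  \<comment> \<open>The mesh for which images have diameter at most \<open>\<delta>\<close>.\<close>
  define \<eta> where "\<eta> = (\<delta> / C) powr (1 / \<alpha>)"
  have \<eta>: "0 < \<eta>" "C * \<eta> powr \<alpha> = \<delta>" using assms(1-3) \<delta> by (simp_all add: \<eta>_def powr_powr)
  have *: "hausdorff_delta s \<delta> (g ` A) \<le> ennreal (C powr s) * (\<Sum>i. ennreal (hterm (\<alpha> * s) (U i)))"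
    if U: "A \<subseteq> \<Union>(range U)" "\<And>i. tdiam (U i) \<le> \<eta>" for U
  proof -
    \<comment> \<open>The Hoelder bound is known on \<open>A\<close> only, hence the intersection
      with \<open>A\<close>.\<close>
    have diam: "tdiam (g ` (U i \<inter> A)) \<le> C * tdiam (U i) powr \<alpha>" for i
    proof (rule tdiam_le)
      fix x y assume "x \<in> g ` (U i \<inter> A)" "y \<in> g ` (U i \<inter> A)"
      then obtain x' y' where xy: "x' \<in> U i \<inter> A" "y' \<in> U i \<inter> A" "x = g x'" "y = g y'" by auto
      then have "tdist x y \<le> C * tdist x' y' powr \<alpha>" using g by auto
      also have "\<dots> \<le> C * tdiam (U i) powr \<alpha>"
        using xy assms(1-3) by (intro mult_left_mono powr_mono2 tdist_le_tdiam tdist_nonneg) auto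
      finally show "tdist x y \<le> C * tdiam (U i) powr \<alpha>" .
    qed (use assms in auto)
    have "hausdorff_delta s \<delta> (g ` A) \<le> (\<Sum>i. ennreal (hterm s (g ` (U i \<inter> A))))"
    proof (rule hausdorff_delta_le)
      fix i
      have "tdiam (g ` (U i \<inter> A)) \<le> C * \<eta> powr \<alpha>"
        using assms(1-3) U(2)[of i]
        by (intro order_trans[OF diam] mult_left_mono powr_mono2 tdiam_nonneg) auto
      then show "tdiam (g ` (U i \<inter> A)) \<le> \<delta>" using \<eta> by simp
    qed (use U(1) in blast)
    also have "\<dots> \<le> (\<Sum>i. ennreal (C powr s) * ennreal (hterm (\<alpha> * s) (U i)))"
    proof (intro suminf_le)
      fix i
      have "hterm s (g ` (U i \<inter> A)) \<le> C powr s * hterm (\<alpha> * s) (U i)"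
      proof (cases "U i \<inter> A = {}")
        case False
        have "hterm s (g ` (U i \<inter> A)) \<le> (C * tdiam (U i) powr \<alpha>) powr s"
          using assms(1-3) by (intro order_trans[OF hterm_le_powr] powr_mono2 diam tdiam_nonneg) auto
        also have "\<dots> = C powr s * hterm (\<alpha> * s) (U i)"
          using assms(1-3) False by (auto simp: hterm_def powr_mult powr_powr)
        finally show ?thesis .
      qed (simp add: hterm_def)
      then show "ennreal (hterm s (g ` (U i \<inter> A))) \<le> ennreal (C powr s) * ennreal (hterm (\<alpha> * s) (U i))"
        by (simp add: ennreal_mult'[symmetric] hterm_nonneg ennreal_leI)
    qed auto
    finally show ?thesis by simp
  qed
  \<comment> \<open>The constant is moved to the left side, so that the infimum over covers is taken
    of a plain covering sum; it is multiplied back at the end.\<close>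
  have inv: "ennreal (C powr s) * ennreal (C powr - s) = 1"
    using assms by (simp add: ennreal_mult'[symmetric] powr_minus field_simps)
  have "ennreal (C powr - s) * hausdorff_delta s \<delta> (g ` A) \<le> hausdorff_delta (\<alpha> * s) \<eta> A"
  proof (rule hausdorff_delta_greatest)
    fix U :: "nat \<Rightarrow> real set" assume "A \<subseteq> \<Union>(range U)" "\<And>i. tdiam (U i) \<le> \<eta>"
    then have "ennreal (C powr - s) * hausdorff_delta s \<delta> (g ` A)
        \<le> ennreal (C powr - s) * (ennreal (C powr s) * (\<Sum>i. ennreal (hterm (\<alpha> * s) (U i))))"
      by (intro mult_left_mono *) auto
    then show "ennreal (C powr - s) * hausdorff_delta s \<delta> (g ` A) \<le> (\<Sum>i. ennreal (hterm (\<alpha> * s) (U i)))"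
      by (simp add: mult.assoc[symmetric] inv mult.commute[of "ennreal (C powr - s)"] del: ennreal_suminf_cmult)
  qed
  also have "\<dots> \<le> hausdorff (\<alpha> * s) A" using \<eta>(1) by (rule hausdorff_delta_le_hausdorff)
  finally have "ennreal (C powr s) * (ennreal (C powr - s) * hausdorff_delta s \<delta> (g ` A))
      \<le> ennreal (C powr s) * hausdorff (\<alpha> * s) A"
    by (intro mult_left_mono) auto
  then show "hausdorff_delta s \<delta> (g ` A) \<le> ennreal (C powr s) * hausdorff (\<alpha> * s) A"
    by (simp add: mult.assoc[symmetric] inv)
qed

text \<open>Hausdorff-Cantelli: every tail of the sequence covers \<open>E\<close>, and the tail
  sums tend to 0.\<close>

lemma hausdorff_limsup_eq_0:
  fixes U :: "nat \<Rightarrow> real set"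
  assumes "0 < s" "summable (\<lambda>i. tdiam (U i) powr s)" "\<And>x. x \<in> E \<Longrightarrow> infinite {i. x \<in> U i}"
  shows "hausdorff s E = 0"
proof -
  have "hausdorff_delta s \<delta> E \<le> 0" if \<delta>: "0 < \<delta>" for \<delta>
  proof (rule ennreal_le_epsilon)
    fix e :: real assume e: "0 < e"
    \<comment> \<open>A tail below \<open>e\<close> bounds the covering sum; a tail below
      \<open>\<delta> powr s\<close> keeps every single diameter within
      \<open>\<delta>\<close>.\<close>
    define r where "r = min e (\<delta> powr s)"
    have "0 < r" using e \<delta> by (simp add: r_def)
    then obtain N where N: "\<And>n. n \<ge> N \<Longrightarrow> norm (\<Sum>i. tdiam (U (i + n)) powr s) < r"
      using suminf_exist_split[OF _ assms(2)] by blast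
    have sm: "summable (\<lambda>i. tdiam (U (i + N)) powr s)" using assms(2) by (rule summable_ignore_initial_segment)
    have tail: "(\<Sum>i. tdiam (U (i + N)) powr s) < r" using N[of N] by auto
    have "hausdorff_delta s \<delta> E \<le> (\<Sum>i. ennreal (hterm s (U (i + N))))"
    proof (rule hausdorff_delta_le)
      show "E \<subseteq> (\<Union>i. U (i + N))"
      proof
        fix x assume "x \<in> E"
        then obtain i where "i \<ge> N" "x \<in> U i" using assms(3)[of x] unfolding infinite_nat_iff_unbounded_le by auto
        then show "x \<in> (\<Union>i. U (i + N))" by (intro UN_I[of "i - N"]) auto
      qed
      fix i
      have "tdiam (U (i + N)) powr s \<le> (\<Sum>i. tdiam (U (i + N)) powr s)"
        using sum_le_suminf[OF sm, of "{i}"] by simp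
      also have "\<dots> < \<delta> powr s" using tail by (simp add: r_def)
      finally show "tdiam (U (i + N)) \<le> \<delta>"
        using \<open>0 < s\<close> \<delta> by (meson not_le powr_mono2 less_imp_le)
    qed
    also have "\<dots> \<le> (\<Sum>i. ennreal (tdiam (U (i + N)) powr s))"
      by (intro suminf_le ennreal_leI hterm_le_powr assms) auto
    also have "\<dots> = ennreal (\<Sum>i. tdiam (U (i + N)) powr s)" by (intro suminf_ennreal2 sm) auto
    also have "\<dots> \<le> ennreal e" using tail by (intro ennreal_leI) (simp add: r_def)
    finally show "hausdorff_delta s \<delta> E \<le> 0 + ennreal e" by simp
  qed
  then have "hausdorff s E \<le> 0" by (rule hausdorff_least)
  then show ?thesis by simp
qed

section \<open>Hausdorff dimension as an infimum of null exponents\<close>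

lemma hdim_le: "0 \<le> s \<Longrightarrow> hausdorff s A = 0 \<Longrightarrow> hdim A \<le> s"
  unfolding hdim_def by (rule cInf_lower) (auto intro: bdd_belowI[of _ 0])

text \<open>The exponent \<open>t\<close> makes the set under the infimum nonempty;
  \<open>Inf\<close> of the empty set of reals carries no information.\<close>

lemma le_hdim:
  assumes "0 \<le> t" "hausdorff t A = 0" "\<And>r. 0 \<le> r \<Longrightarrow> r < s \<Longrightarrow> hausdorff r A \<noteq> 0"
  shows "s \<le> hdim A"
  unfolding hdim_def using assms by (intro cInf_greatest) (auto simp: not_le[symmetric])

section \<open>Cylinders, the Cantor measure and neighbourhoods of the Cantor set\<close>

definition cwords :: "nat \<Rightarrow> nat set" where
  "cwords n = range (\<lambda>a. cpre a n)"

text \<open>An affine copy of the whole Cantor set, so that cylinders of one level are rotations of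
  each other. For \<open>i \<in> cwords n\<close>, \<open>frac\<close> only moves the point 1 to
  0.\<close>

definition cyl :: "nat \<Rightarrow> nat \<Rightarrow> real set" where
  "cyl n i = frac ` (\<lambda>x. (real i + x) / 3 ^ n) ` cantor_set"

text \<open>The digits of \<open>x\<close> are appended to the word \<open>i\<close>.\<close>

lemma cwords_cases:
  assumes "i \<in> cwords n" "x \<in> cantor_set"
  obtains a where "cpre a n = i" "cval a = (real i + x) / 3 ^ n"
proof -
  obtain a c where a: "i = cpre a n" "x = cval c"
    using assms by (auto simp: cwords_def cantor_set_eq)
  define d where "d t = (if t < n then a t else c (t - n))" for t
  have "cpre d n = i" by (simp add: a cpre_eq_iff d_def)
  moreover have "cval d = (real i + x) / 3 ^ n"
    using cval_cpre[of d n] \<open>cpre d n = i\<close> by (simp add: d_def a)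
  ultimately show ?thesis by (rule that)
qed

lemma mem_cyl_cpre:
  assumes "y \<in> cyl n (cpre a n)"
  obtains a' where "\<And>i. i < n \<Longrightarrow> a' i = a i" "y = frac (cval a')"
proof -
  obtain x where x: "x \<in> cantor_set" "y = frac ((real (cpre a n) + x) / 3 ^ n)"
    using assms by (auto simp: cyl_def)
  have "cpre a n \<in> cwords n" by (simp add: cwords_def)
  then obtain a' where "cpre a' n = cpre a n" "cval a' = (real (cpre a n) + x) / 3 ^ n"
    using x(1) by (rule cwords_cases)
  then show ?thesis using that[of a'] x(2) by (simp add: cpre_eq_iff)
qed

lemma cantorK_eq: "cantorK = range (\<lambda>a. frac (cval a))"
  by (auto simp: cantorK_def cantor_set_eq)

lemma cyl_subset_cantorK: "i \<in> cwords n \<Longrightarrow> cyl n i \<subseteq> cantorK"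
  by (auto simp: cantorK_eq cwords_def elim: mem_cyl_cpre)

lemma cantorK_eq_UN: "cantorK = (\<Union>i\<in>cwords n. cyl n i)"
proof (intro equalityI subsetI)
  fix y assume "y \<in> cantorK"
  then obtain a where "y = frac (cval a)" by (auto simp: cantorK_eq)
  then have "y = frac ((real (cpre a n) + cval (\<lambda>i. a (i + n))) / 3 ^ n)"
    using cval_cpre[of a n] by simp
  then have "y \<in> cyl n (cpre a n)" unfolding cyl_def cantor_set_eq by blast
  then show "y \<in> (\<Union>i\<in>cwords n. cyl n i)" by (auto simp: cwords_def)
qed (use cyl_subset_cantorK in blast)

text \<open>Before reduction the cylinder is a compact subset of \<open>[0, 1]\<close>, on which
  \<open>frac\<close> changes only the point 1.\<close>

lemma cyl_borel:
  assumes "i \<in> cwords n"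
  shows "cyl n i \<in> sets borel"
proof -
  let ?S = "(\<lambda>x. (real i + x) / 3 ^ n) ` cantor_set"
  have "compact cantor_set"
    using cantor_bounds by (auto simp: compact_eq_bounded_closed closed_cantor_set bounded_iff intro!: exI[of _ 1])
  then have "compact ?S" by (intro compact_continuous_image continuous_intros) auto
  then have S: "?S \<in> sets borel" by (intro borel_closed compact_imp_closed)
  have S01: "0 \<le> x \<and> x \<le> 1" if x: "x \<in> ?S" for x
  proof -
    obtain z where "z \<in> cantor_set" "x = (real i + z) / 3 ^ n" using x by auto
    then obtain a where "x = cval a" using assms by (metis cwords_cases)
    then show ?thesis by (simp add: cval_nonneg cval_le_1)
  qed
  have fr: "frac x = (if x = 1 then 0 else x)" if "x \<in> ?S" for x
    using S01[OF that] by (auto simp: frac_eq)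
  have "cyl n i = (?S - {1}) \<union> (if 1 \<in> ?S then {0} else {})"
    unfolding cyl_def by (auto simp: fr image_iff)
  then show ?thesis using S by simp
qed

lemma cwords_Suc: "cwords (Suc n) = (\<lambda>i. 3 * i) ` cwords n \<union> (\<lambda>i. 3 * i + 2) ` cwords n"
proof (intro equalityI subsetI)
  fix k assume "k \<in> (\<lambda>i. 3 * i) ` cwords n \<union> (\<lambda>i. 3 * i + 2) ` cwords n"
  then obtain a p where k: "k = 3 * cpre a n + 2 * of_bool p"
    by (fastforce simp: cwords_def)
  have "cpre (a(n := p)) n = cpre a n" by (simp add: cpre_eq_iff)
  then have "cpre (a(n := p)) (Suc n) = k" by (simp add: k)
  then show "k \<in> cwords (Suc n)" unfolding cwords_def by blast
qed (auto simp: cwords_def)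

lemma finite_cwords: "finite (cwords n)"
  by (induction n) (simp add: cwords_def, simp add: cwords_Suc)

lemma card_cwords: "card (cwords n) = 2 ^ n"
proof (induction n)
  case (Suc n)
  have "3 * i \<noteq> 3 * j + 2" for i j :: nat by presburger
  then have "(\<lambda>i. 3 * i) ` cwords n \<inter> (\<lambda>i. 3 * i + 2) ` cwords n = {}" by auto
  then show ?case using Suc
    by (simp add: cwords_Suc card_Un_disjoint finite_cwords card_image inj_on_def)
qed (simp add: cwords_def)

lemma cpre_less: "cpre a n < 3 ^ n"
  by (induction n) auto

section \<open>Counting the fractions of a generation that lie in the Cantor set\<close>

lemma finite_Kset: "finite (Kset b j)"
  unfolding Kset_def by (rule finite_subset[of _ "{..<b ^ j}"]) auto

lemma KsetK_subset: "KsetK b j \<subseteq> Kset b j"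
  by (auto simp: KsetK_def)

lemma finite_KsetK: "finite (KsetK b j)"
  using finite_subset[OF KsetK_subset finite_Kset] .

lemma card_Kset_le: "card (Kset b j) \<le> b ^ j"
  using card_mono[of "{..<b ^ j}" "Kset b j"] by (auto simp: Kset_def)

lemma cval_False: "cval (\<lambda>_. False) = 0"
  by (simp add: cval_def)

text \<open>Words ending in the digit 2 are not divisible by 3, hence coprime to powers of 3, and
  their fractions are left end points of cylinders. They are half of all words of length
  \<open>Suc n\<close>.\<close>

lemma card_KsetK_ge:
  assumes "m * j = Suc n"
  shows "2 ^ n \<le> card (KsetK (3 ^ m) j)"
proof -
  have "(\<lambda>i. 3 * i + 2) ` cwords n \<subseteq> KsetK (3 ^ m) j"
  proof safe
    fix i assume "i \<in> cwords n"
    then obtain a where i: "i = cpre a n" by (auto simp: cwords_def)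
    define k where "k = 3 * i + 2"
    have "k \<in> cwords (Suc n)" using \<open>i \<in> cwords n\<close> by (simp add: cwords_Suc k_def)
    moreover have "0 \<in> cantor_set" using cval_False by (metis cantor_set_eq rangeI)
    ultimately obtain c where c: "cpre c (Suc n) = k" "cval c = (real k + 0) / 3 ^ Suc n"
      by (rule cwords_cases)
    have lt: "k < 3 ^ Suc n" using cpre_less[of c "Suc n"] c by simp
    have "\<not> 3 dvd k" unfolding k_def by presburger
    then have "coprime 3 k" by (intro prime_imp_coprime) auto
    then have cop: "coprime k (3 ^ Suc n)" by (simp add: coprime_commute coprime_power_right_iff)
    have "real k < 3 ^ Suc n" using lt by (metis of_nat_less_iff of_nat_numeral of_nat_power)
    then have "frac (cval c) = real k / 3 ^ Suc n" unfolding c(2) add_0_right by (subst frac_eq) simp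
    then have "real k / 3 ^ Suc n \<in> cantorK" by (metis cantorK_eq rangeI)
    then have "k \<in> KsetK (3 ^ m) j"
      using lt cop unfolding KsetK_def Kset_def
      by (simp add: assms flip: power_mult del: power_Suc)
    then show "3 * i + 2 \<in> KsetK (3 ^ m) j" by (simp add: k_def)
  qed
  then have "card ((\<lambda>i. 3 * i + 2) ` cwords n) \<le> card (KsetK (3 ^ m) j)"
    by (intro card_mono finite_KsetK)
  then show ?thesis by (simp add: card_image inj_on_def card_cwords)
qed

text \<open>If \<open>k / 3 ^ n\<close> lies in the Cantor set, \<open>k\<close> is a prefix plus a
  tail in \<open>[0, 1]\<close>; integrality makes the tail 0 or 1, so \<open>k\<close> is a word or
  the successor of one.\<close>

lemma card_KsetK_le: "card (KsetK (3 ^ m) j) \<le> 2 * 2 ^ (m * j)"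
proof -
  define n where "n = m * j"
  have "KsetK (3 ^ m) j \<subseteq> cwords n \<union> Suc ` cwords n"
  proof
    fix k assume "k \<in> KsetK (3 ^ m) j"
    then have "real k / 3 ^ n \<in> cantorK" by (simp add: KsetK_def n_def power_mult)
    then obtain a where a: "real k / 3 ^ n = frac (cval a)" by (auto simp: cantorK_eq)
    show "k \<in> cwords n \<union> Suc ` cwords n"
    \<comment> \<open>The point 1 is reduced to 0, which belongs to the word of zeros.\<close>
    proof (cases "cval a = 1")
      case True
      then have "k = 0" using a by simp
      have "cpre (\<lambda>_. False) n = 0" by (induction n) auto
      then have "0 \<in> cwords n" by (metis cwords_def rangeI)
      then show ?thesis using \<open>k = 0\<close> by simp
    next
      case False
      then have "frac (cval a) = cval a"
        using cval_nonneg[of a] cval_le_1[of a] by (subst frac_eq) simp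
      then have "real k = real (cpre a n) + cval (\<lambda>i. a (i + n))"
        using a cval_cpre[of a n] by (simp add: field_simps)
      then have "k = cpre a n \<or> k = Suc (cpre a n)"
        using cval_nonneg[of "\<lambda>i. a (i + n)"] cval_le_1[of "\<lambda>i. a (i + n)"] by linarith
      then show ?thesis by (auto simp: cwords_def)
    qed
  qed
  then have "card (KsetK (3 ^ m) j) \<le> card (cwords n \<union> Suc ` cwords n)"
    by (intro card_mono) (auto simp: finite_cwords)
  also have "\<dots> \<le> card (cwords n) + card (cwords n)"
    using card_Un_le[of "cwords n" "Suc ` cwords n"] by (simp add: card_image)
  finally show ?thesis by (simp add: card_cwords n_def)
qed

section \<open>Hausdorff and Cantor measure of cylinders\<close>

lemma kappa_pos: "0 < kappa" and kappa_less_1: "kappa < 1" and powr_kappa: "3 powr kappa = 2"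
  by (simp_all add: kappa_def powr_def)

text \<open>Rotation by \<open>(i - i') / 3 ^ n\<close> maps one cylinder onto the other and is an
  isometry, the Hoelder case with both constants 1. Exchanging \<open>i\<close> and
  \<open>i'\<close> gives equality.\<close>

lemma hausdorff_cyl_le:
  "hausdorff kappa (cyl n i) \<le> hausdorff kappa (cyl n i')"
proof -
  define g where "g x = frac (x + (real i - real i') / 3 ^ n)" for x :: real
  have "g (frac ((real i' + x) / 3 ^ n)) = frac ((real i + x) / 3 ^ n)" for x
  proof -
    let ?z = "(real i' + x) / 3 ^ n"
    have "frac ?z + (real i - real i') / 3 ^ n = (real i + x) / 3 ^ n - of_int \<lfloor>?z\<rfloor>"
      by (simp add: frac_def add_divide_distrib diff_divide_distrib)
    then show ?thesis by (simp only: g_def frac_def floor_diff_of_int of_int_diff)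
  qed
  then have "cyl n i = g ` cyl n i'" by (simp add: cyl_def image_image)
  moreover have "tdist (g x) (g y) \<le> 1 * tdist x y powr 1" for x y
    by (simp add: g_def tdist_frac tdist_nonneg) (simp add: tdist_def)
  ultimately show ?thesis
    using hausdorff_Hoelder_image[OF kappa_pos, of 1 1 "cyl n i'" g] by simp
qed

lemma hausdorff_cantorK_le:
  assumes "i \<in> cwords n"
  shows "hausdorff kappa cantorK \<le> 2 ^ n * hausdorff kappa (cyl n i)"
proof -
  have "hausdorff kappa cantorK \<le> (\<Sum>i\<in>cwords n. hausdorff kappa (cyl n i))"
    by (subst cantorK_eq_UN[of n]) (intro hausdorff_UN finite_cwords)
  also have "\<dots> \<le> (\<Sum>i'\<in>cwords n. hausdorff kappa (cyl n i))"
    by (intro sum_mono hausdorff_cyl_le)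
  finally show ?thesis by (simp add: card_cwords)
qed

text \<open>
  \<^const>\<open>measure_of\<close> returns the null measure when the given set function is not a measure.
  So the assumption below carries real information: the normalised Hausdorff measure is
  countably additive on Borel sets, and the Hausdorff measure of the Cantor set is positive
  and finite.
\<close>

context
  assumes prob_cantor: "prob_space cantor_measure"
begin

lemma emeasure_cantor_measure:
  assumes "A \<in> sets borel"
  shows "emeasure cantor_measure A = hausdorff kappa (A \<inter> cantorK) / hausdorff kappa cantorK"
proof -
  let ?\<mu> = "\<lambda>A. hausdorff kappa (A \<inter> cantorK) / hausdorff kappa cantorK"
  have sig: "sigma_sets UNIV (sets borel) = sets (borel :: real measure)"
    by (metis sets.sigma_sets_eq space_borel)
  have eq: "emeasure cantor_measure B = (if B \<in> sets borel \<and> measure_space UNIV (sets borel) ?\<mu> then ?\<mu> B else 0)" for B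
    unfolding cantor_measure_def by (simp add: emeasure_measure_of_conv sig)
  have "space cantor_measure = UNIV" by (simp add: cantor_measure_def space_measure_of_conv)
  then have "emeasure cantor_measure UNIV = 1" using prob_space.emeasure_space_1[OF prob_cantor] by simp
  then have "measure_space UNIV (sets borel) ?\<mu>" using eq[of UNIV] by (metis zero_neq_one)
  then show ?thesis using eq[of A] assms by simp
qed

lemma hausdorff_cantorK: "hausdorff kappa cantorK \<noteq> 0" "hausdorff kappa cantorK \<noteq> top"
proof -
  have "space cantor_measure = UNIV" by (simp add: cantor_measure_def space_measure_of_conv)
  \<comment> \<open>In \<open>ennreal\<close> both \<open>0 / 0\<close> and \<open>top / top\<close>
    are 0, so total mass 1 rules out both values.\<close>
  then have "hausdorff kappa cantorK / hausdorff kappa cantorK = 1"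
    using prob_space.emeasure_space_1[OF prob_cantor] emeasure_cantor_measure[of UNIV] by simp
  then show "hausdorff kappa cantorK \<noteq> 0" "hausdorff kappa cantorK \<noteq> top"
    by (auto simp: ennreal_top_divide)
qed

lemma emeasure_cyl_ge:
  assumes "i \<in> cwords n"
  shows "ennreal (1 / 2 ^ n) \<le> emeasure cantor_measure (cyl n i)"
proof -
  have le: "hausdorff kappa (cyl n i) \<le> hausdorff kappa cantorK"
    by (intro hausdorff_mono cyl_subset_cantorK assms)
  obtain h where h: "hausdorff kappa cantorK = ennreal h" "0 < h"
    using hausdorff_cantorK by (cases "hausdorff kappa cantorK") (auto simp: less_le)
  obtain c where c: "hausdorff kappa (cyl n i) = ennreal c" "0 \<le> c"
    using le h by (cases "hausdorff kappa (cyl n i)") (auto simp: top_unique)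
  have "ennreal h \<le> ennreal (2 ^ n * c)"
    using hausdorff_cantorK_le[OF assms] h c by (simp add: ennreal_mult ennreal_power[symmetric])
  then have "h \<le> 2 ^ n * c" using c by (simp add: ennreal_le_iff)
  then have "1 / 2 ^ n \<le> c / h" using h by (simp add: field_simps)
  then have "ennreal (1 / 2 ^ n) \<le> ennreal c / ennreal h"
    using h c by (simp add: divide_ennreal ennreal_leI)
  moreover have "cyl n i \<inter> cantorK = cyl n i" using cyl_subset_cantorK[OF assms] by auto
  ultimately show ?thesis using emeasure_cantor_measure[OF cyl_borel[OF assms]] h c by simp
qed

end

section \<open>Lebesgue measure near the Cantor set\<close>

lemma measurable_tdist [measurable]: "tdist x \<in> borel_measurable borel"
  unfolding tdist_def frac_def by measurable

text \<open>Seen in \<open>[0, 1)\<close>, a ball of the circle lies in three translates of an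
  interval of length \<open>2 * \<rho>\<close>.\<close>

lemma emeasure_torus_lebesgue_tdist:
  assumes "0 \<le> x" "x \<le> 1" "0 \<le> \<rho>"
  shows "emeasure torus_lebesgue {y. tdist x y \<le> \<rho>} \<le> ennreal (6 * \<rho>)"
proof -
  let ?A = "{y. tdist x y \<le> \<rho>}"
  let ?I = "\<lambda>c. {x + c - \<rho>..x + c + \<rho>}"
  have A: "?A \<in> sets lborel" by measurable
  have "emeasure torus_lebesgue ?A = emeasure lborel ({0..<1} \<inter> ?A)"
    using A by (simp add: torus_lebesgue_def emeasure_density flip: indicator_inter_arith)
  also have "\<dots> \<le> emeasure lborel (?I 0 \<union> ?I 1 \<union> ?I (- 1))"
  proof (intro emeasure_mono subsetI)
    fix y assume y: "y \<in> {0..<1} \<inter> ?A"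
    obtain k where k: "tdist x y = \<bar>x - y - of_int k\<bar>" by (rule tdist_attained)
    have "\<bar>real_of_int k\<bar> < 2" using k tdist_le_half[of x y] y assms unfolding Int_iff atLeastLessThan_iff by linarith
    then have "k = 0 \<or> k = 1 \<or> k = - 1" by linarith
    then show "y \<in> ?I 0 \<union> ?I 1 \<union> ?I (- 1)" using k y by auto
  qed auto
  also have "\<dots> \<le> emeasure lborel (?I 0) + emeasure lborel (?I 1) + emeasure lborel (?I (- 1))"
    by (intro order_trans[OF emeasure_subadditive] add_mono) auto
  also have "\<dots> = ennreal (6 * \<rho>)" using assms by (simp add: ennreal_plus[symmetric] del: ennreal_plus)
  finally show ?thesis .
qed

text \<open>With \<open>1 / 3 ^ q\<close> comparable to \<open>r\<close>, the neighbourhood lies in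
  \<open>2 ^ q\<close> balls of radius \<open>2 / 3 ^ q\<close>, and
  \<open>2 ^ q / 3 ^ q = (1 / 3 ^ q) powr (1 - kappa)\<close>.\<close>

lemma cantorK_neighbourhood:
  assumes "0 < r" "r \<le> 1"
  obtains B where "B \<in> sets borel" "\<And>\<xi> y. \<xi> \<in> cantorK \<Longrightarrow> tdist \<xi> y < r \<Longrightarrow> y \<in> B"
    "emeasure torus_lebesgue B \<le> ennreal (36 * r powr (1 - kappa))"
proof -
  \<comment> \<open>Chosen such that \<open>r \<le> 1 / 3 ^ q \<le> 3 * r\<close>.\<close>
  define q where "q = nat \<lfloor>- log 3 r\<rfloor>"
  have "log 3 r \<le> 0" using assms by simp
  then have q: "real q \<le> - log 3 r" "- log 3 r < real q + 1" unfolding q_def by linarith+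
  have "3 powr (log 3 r) \<le> 3 powr (- real q)" using q by (intro powr_mono) auto
  then have rq: "r \<le> 1 / 3 ^ q" using assms by (simp add: powr_minus powr_realpow field_simps)
  have "3 powr (- real q) \<le> 3 powr (1 + log 3 r)" using q by (intro powr_mono) auto
  then have qr: "1 / 3 ^ q \<le> 3 * r" using assms by (simp add: powr_minus powr_realpow powr_add field_simps)
  \<comment> \<open>The centres are left end points of level \<open>q\<close>. One summand
    \<open>1 / 3 ^ q\<close> is the distance from the Cantor point to its centre, the other bounds
    \<open>r\<close>.\<close>
  define B where "B = (\<Union>i\<in>cwords q. {y. tdist (real i / 3 ^ q) y \<le> 2 / 3 ^ q})"
  have "{y. tdist x y \<le> c} \<in> sets borel" for x c by measurable
  then have B: "B \<in> sets borel" unfolding B_def by (intro sets.finite_UN finite_cwords)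
  moreover have "y \<in> B" if \<xi>: "\<xi> \<in> cantorK" "tdist \<xi> y < r" for \<xi> y
  proof -
    obtain a where a: "\<xi> = frac (cval a)" using \<xi>(1) by (auto simp: cantorK_eq)
    have "\<bar>cval a - real (cpre a q) / 3 ^ q\<bar> \<le> 1 / 3 ^ q"
      using cval_nonneg[of "\<lambda>i. a (i + q)"] cval_le_1[of "\<lambda>i. a (i + q)"]
      by (subst cval_cpre[of a q]) (simp add: add_divide_distrib divide_right_mono)
    then have "tdist \<xi> (real (cpre a q) / 3 ^ q) \<le> 1 / 3 ^ q"
      using tdist_le_abs[of "cval a" "real (cpre a q) / 3 ^ q"] by (simp add: a tdist_frac_left)
    then have "tdist (real (cpre a q) / 3 ^ q) y \<le> 2 / 3 ^ q"
      using tdist_triangle[of "real (cpre a q) / 3 ^ q" y \<xi>] \<xi>(2) rq by (simp add: tdist_commute)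
    then show "y \<in> B" by (auto simp: B_def cwords_def)
  qed
  moreover have "emeasure torus_lebesgue B \<le> ennreal (36 * r powr (1 - kappa))"
  proof -
    have "emeasure torus_lebesgue B \<le> (\<Sum>i\<in>cwords q. emeasure torus_lebesgue {y. tdist (real i / 3 ^ q) y \<le> 2 / 3 ^ q})"
      unfolding B_def by (intro emeasure_subadditive_finite finite_cwords) (auto simp: torus_lebesgue_def)
    also have "\<dots> \<le> (\<Sum>i\<in>cwords q. ennreal (6 * (2 / 3 ^ q)))"
    proof (intro sum_mono emeasure_torus_lebesgue_tdist)
      fix i assume "i \<in> cwords q"
      then have "i < 3 ^ q" using cpre_less by (auto simp: cwords_def)
      then have "real i < 3 ^ q" by (metis of_nat_less_iff of_nat_numeral of_nat_power)
      then show "real i / 3 ^ q \<le> 1" by simp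
    qed auto
    also have "\<dots> = ennreal (12 * (2 ^ q / 3 ^ q))"
    proof -
      have "ennreal (12 * (2 ^ q / 3 ^ q)) = ennreal (real (2 ^ q)) * ennreal (6 * (2 / 3 ^ q))"
        by (subst ennreal_mult'[symmetric]) simp_all
      then show ?thesis by (simp only: sum_constant card_cwords ennreal_of_nat_eq_real_of_nat)
    qed
    also have "\<dots> \<le> ennreal (36 * r powr (1 - kappa))"
    proof (intro ennreal_leI)
      have "(2::real) ^ q = 3 powr (kappa * real q)"
        by (simp add: powr_kappa powr_powr[symmetric] powr_realpow)
      then have "(2::real) ^ q / 3 ^ q = (1 / 3 ^ q) powr (1 - kappa)"
        by (simp add: powr_divide powr_realpow[symmetric] powr_powr powr_diff[symmetric] powr_minus[symmetric] field_simps powr_add[symmetric] del: powr_realpow)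
      also have "\<dots> \<le> (3 * r) powr (1 - kappa)"
        using qr kappa_less_1 by (intro powr_mono2) auto
      \<comment> \<open>The factor \<open>3 powr (1 - kappa)\<close> is at most 3, which turns 12
        into 36.\<close>
      also have "\<dots> \<le> 3 * r powr (1 - kappa)"
        using assms kappa_pos powr_mono[of "1 - kappa" 1 3] by (simp add: powr_mult mult_right_mono)
      finally show "12 * (2 ^ q / 3 ^ q) \<le> 36 * r powr (1 - kappa)" by simp
    qed
    finally show ?thesis .
  qed
  ultimately show ?thesis by (rule that)
qed

section \<open>Ubiquity of the random points\<close>

locale cantor_points = prob_space M for M :: "'a measure" +
  fixes Y :: "nat \<times> nat \<Rightarrow> 'a \<Rightarrow> real" and m b :: nat
  assumes m: "m \<ge> 1" and b: "b = 3 ^ m"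
    and indep: "indep_vars (\<lambda>_. borel) Y {(j, k). j \<ge> 1 \<and> k \<in> Kset b j}"
    and distr_KsetK: "j \<ge> 1 \<Longrightarrow> k \<in> KsetK b j \<Longrightarrow> distr M borel (Y (j, k)) = cantor_measure"
    and distr_Kset: "j \<ge> 1 \<Longrightarrow> k \<in> Kset b j - KsetK b j \<Longrightarrow> distr M borel (Y (j, k)) = torus_lebesgue"
begin

lemma measurable_Y: "j \<ge> 1 \<Longrightarrow> k \<in> Kset b j \<Longrightarrow> Y (j, k) \<in> borel_measurable M"
  using indep unfolding indep_vars_def2 by auto

lemma card_KsetK_ge': "j \<ge> 1 \<Longrightarrow> 2 ^ (m * j - 1) \<le> card (KsetK b j)"
  using card_KsetK_ge[of m j "m * j - 1"] m b by simp

text \<open>\<open>KsetK b 1\<close> is nonempty, so \<open>cantor_measure\<close> is the law of a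
  random variable. This discharges the assumption under which its values were computed.\<close>

lemma prob_cantor: "prob_space cantor_measure"
proof -
  have "0 < card (KsetK b 1)" using card_KsetK_ge'[of 1] by (metis gr0I le_refl not_le power_eq_0_iff zero_neq_numeral)
  then obtain k where k: "k \<in> KsetK b 1" by (auto simp: card_gt_0_iff)
  then have "k \<in> Kset b 1" using KsetK_subset by blast
  then have "prob_space (distr M borel (Y (1, k)))" by (intro prob_space_distr measurable_Y) auto
  then show ?thesis using distr_KsetK[of 1 k] k by simp
qed

lemma prob_cyl_ge:
  assumes "j \<ge> 1" "k \<in> KsetK b j" "i \<in> cwords l"
  shows "1 / 2 ^ l \<le> prob (Y (j, k) -` cyl l i \<inter> space M)"
proof -
  have Y: "Y (j, k) \<in> borel_measurable M" using assms KsetK_subset by (intro measurable_Y) auto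
  have "ennreal (1 / 2 ^ l) \<le> emeasure M (Y (j, k) -` cyl l i \<inter> space M)"
    using emeasure_cyl_ge[OF prob_cantor assms(3)] emeasure_distr[OF Y cyl_borel[OF assms(3)]] distr_KsetK[OF assms(1,2)] by simp
  then show ?thesis by (simp add: emeasure_eq_measure)
qed

text \<open>With \<open>n = m * j\<close> this is about \<open>n * (1 - 1 / p)\<close>: some
  \<open>2 ^ n\<close> Cantor points face \<open>2 ^ level p j\<close> cylinders, a surplus of order
  \<open>2 powr (n / p)\<close> per cylinder.\<close>

definition level :: "nat \<Rightarrow> nat \<Rightarrow> nat" where
  "level p j = m * j - (m * j) div p"

definition hit :: "nat \<Rightarrow> nat \<Rightarrow> 'a \<Rightarrow> bool" where
  "hit p j \<omega> \<longleftrightarrow> (\<forall>i\<in>cwords (level p j). \<exists>k\<in>KsetK b j. Y (j, k) \<omega> \<in> cyl (level p j) i)"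

lemma level_ge: "real (m * j) * (1 - 1 / real p) \<le> real (level p j)"
proof -
  have "real ((m * j) div p) \<le> real (m * j) / real p" by (rule of_nat_div_le_of_nat)
  moreover have "real (level p j) = real (m * j) - real ((m * j) div p)"
    by (simp add: level_def of_nat_diff)
  ultimately show ?thesis by (simp add: algebra_simps)
qed

lemma KsetK_nonempty: "j \<ge> 1 \<Longrightarrow> KsetK b j \<noteq> {}"
  using card_KsetK_ge'[of j] by (metis card.empty le_zero_eq power_eq_0_iff zero_neq_numeral)

definition miss_at :: "nat \<Rightarrow> nat \<Rightarrow> nat \<Rightarrow> 'a set" where
  "miss_at j l i = {\<omega> \<in> space M. \<forall>k\<in>KsetK b j. Y (j, k) \<omega> \<notin> cyl l i}"

text \<open>The index set is nonempty for \<open>j \<ge> 1\<close>; an empty intersection would be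
  \<open>UNIV\<close> and leave \<open>space M\<close>.\<close>

lemma miss_at_eq: "j \<ge> 1 \<Longrightarrow> miss_at j l i = (\<Inter>k\<in>KsetK b j. Y (j, k) -` (- cyl l i) \<inter> space M)"
  using KsetK_nonempty[of j] by (auto simp: miss_at_def)

lemma miss_at_measurable:
  assumes "j \<ge> 1" "i \<in> cwords l"
  shows "miss_at j l i \<in> sets M"
  unfolding miss_at_eq[OF assms(1)]
  using assms KsetK_subset[of b j] cyl_borel[OF assms(2)]
  by (intro sets.finite_INT finite_KsetK KsetK_nonempty measurable_sets[OF measurable_Y]) auto

text \<open>Nothing is assumed about \<open>Y (0, k)\<close>, so the event is empty for
  \<open>j = 0\<close>, which keeps it measurable for every \<open>j\<close>.\<close>

definition miss :: "nat \<Rightarrow> nat \<Rightarrow> 'a set" where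
  "miss p j = (if j = 0 then {} else \<Union>i\<in>cwords (level p j). miss_at j (level p j) i)"

lemma miss_measurable: "miss p j \<in> sets M"
  unfolding miss_def by (auto intro!: sets.finite_UN finite_cwords miss_at_measurable)

text \<open>Independence and \<open>1 - x \<le> exp (- x)\<close> bound the probability of missing
  one cylinder; the union bound over at most \<open>2 ^ (m * j)\<close> cylinders gives the first
  factor.\<close>

lemma prob_miss_le:
  assumes "j \<ge> 1" "p \<ge> 1"
  shows "prob (miss p j) \<le> 2 powr (real m * real j) * exp (- (2 powr (real m / real p * real j - 2)))"
proof -
  define l where "l = level p j"
  have prob_i: "prob (miss_at j l i) \<le> exp (- (2 powr (real m / real p * real j - 2)))"
    if i: "i \<in> cwords l" for i
  proof -
    have eq: "miss_at j l i = (\<Inter>x\<in>Pair j ` KsetK b j. Y x -` (- cyl l i) \<inter> space M)"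
      unfolding miss_at_eq[OF assms(1)] by blast
    have "prob (\<Inter>x\<in>Pair j ` KsetK b j. Y x -` (- cyl l i) \<inter> space M)
        = (\<Prod>x\<in>Pair j ` KsetK b j. prob (Y x -` (- cyl l i) \<inter> space M))"
      using assms(1) KsetK_subset[of b j] KsetK_nonempty[OF assms(1)] cyl_borel[OF i]
      by (intro indep_varsD[OF indep]) (auto simp: finite_KsetK)
    also have "\<dots> = (\<Prod>k\<in>KsetK b j. prob (Y (j, k) -` (- cyl l i) \<inter> space M))"
      by (subst prod.reindex) (auto simp: inj_on_def)
    also have "\<dots> \<le> (\<Prod>k\<in>KsetK b j. exp (- (1 / 2 ^ l)))"
    proof (intro prod_mono conjI)
      fix k assume k: "k \<in> KsetK b j"
      let ?E = "Y (j, k) -` cyl l i \<inter> space M"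
      have "?E \<in> sets M"
        using k KsetK_subset assms(1) by (intro measurable_sets[OF measurable_Y cyl_borel[OF i]]) auto
      moreover have "Y (j, k) -` (- cyl l i) \<inter> space M = space M - ?E" by auto
      ultimately have "prob (Y (j, k) -` (- cyl l i) \<inter> space M) = 1 - prob ?E" by (simp add: prob_compl)
      also have "\<dots> \<le> 1 + (- (1 / 2 ^ l))" using prob_cyl_ge[OF assms(1) k i] by simp
      also have "\<dots> \<le> exp (- (1 / 2 ^ l))" by (rule exp_ge_add_one_self)
      finally show "prob (Y (j, k) -` (- cyl l i) \<inter> space M) \<le> exp (- (1 / 2 ^ l))" .
    qed auto
    also have "\<dots> = exp (- (real (card (KsetK b j)) / 2 ^ l))"
      by (simp add: exp_of_nat_mult[symmetric])
    also have "\<dots> \<le> exp (- (2 powr (real m / real p * real j - 2)))"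
    proof -
      \<comment> \<open>The loss of 2 in the exponent: 1 for the rounding in \<open>div\<close>, 1
        for the cardinality bound \<open>2 ^ (m * j - 1)\<close>.\<close>
      have pos: "m * j \<ge> 1" using m assms(1) by simp
      have "real m / real p * real j = real (m * j) / real p" by simp
      also have "\<dots> \<le> real ((m * j) div p) + 1"
        using floor_correct[of "real (m * j) / real p"]
        unfolding floor_divide_of_nat_eq of_int_of_nat_eq by linarith
      finally have "real m / real p * real j - 2 \<le> real (m * j - 1) - real l"
        using pos by (simp add: l_def level_def of_nat_diff)
      then have "2 powr (real m / real p * real j - 2) \<le> 2 powr (real (m * j - 1) - real l)"
        by (intro powr_mono) auto
      also have "\<dots> = 2 ^ (m * j - 1) / 2 ^ l" by (simp add: powr_diff powr_realpow)
      also have "\<dots> \<le> real (card (KsetK b j)) / 2 ^ l"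
        using card_KsetK_ge'[OF assms(1)] by (intro divide_right_mono) (auto simp flip: of_nat_le_iff)
      finally show ?thesis by simp
    qed
    finally show ?thesis using eq by simp
  qed
  have "prob (miss p j) \<le> (\<Sum>i\<in>cwords l. prob (miss_at j l i))"
    using assms(1) unfolding miss_def l_def
    by (auto intro!: finite_measure_subadditive_finite finite_cwords miss_at_measurable)
  also have "\<dots> \<le> (\<Sum>i\<in>cwords l. exp (- (2 powr (real m / real p * real j - 2))))"
    by (intro sum_mono prob_i)
  also have "\<dots> = 2 ^ l * exp (- (2 powr (real m / real p * real j - 2)))"
    by (simp add: card_cwords)
  also have "\<dots> \<le> 2 powr (real m * real j) * exp (- (2 powr (real m / real p * real j - 2)))"
    by (intro mult_right_mono) (auto simp: l_def level_def powr_realpow simp flip: of_nat_mult)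
  finally show ?thesis .
qed

text \<open>Doubly exponential decay beats the number of cylinders, so Borel-Cantelli applies. The
  arguments for (1) and for the lower bound then fix an outcome in this event.\<close>

lemma AE_hit:
  assumes "p \<ge> 1"
  shows "AE \<omega> in M. eventually (\<lambda>j. hit p j \<omega>) sequentially"
proof -
  define f where "f j = 2 powr (real m * real j) * exp (- (2 powr (real m / real p * real j - 2)))" for j
  define c d where "c = real m" and "d = real m / real p"
  have "0 < c" "0 < d" using m assms by (simp_all add: c_def d_def)
  then have "(\<lambda>j. 2 powr (c * real j) * exp (- (2 powr (d * real j - 2)))) \<in> O(\<lambda>j. 1 / real j ^ 2)"
    by real_asymp
  then have "f \<in> O(\<lambda>j. 1 / real j ^ 2)" unfolding f_def[abs_def] c_def d_def .
  moreover have "summable (\<lambda>j. norm (1 / real j ^ 2))"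
    using inverse_power_summable[of 2, where 'a = real] by (simp add: inverse_eq_divide)
  ultimately have "summable f" by (rule summable_comparison_test_bigo[rotated])
  then have "summable (\<lambda>j. prob (miss p j))"
  proof (rule summable_comparison_test'[of _ 1])
    show "norm (prob (miss p j)) \<le> f j" if "j \<ge> 1" for j
      using prob_miss_le[OF that assms] by (simp add: f_def)
  qed
  then have "AE \<omega> in M. eventually (\<lambda>j. \<omega> \<in> space M - miss p j) sequentially"
    by (intro borel_cantelli_AE1 miss_measurable) (auto simp: less_top[symmetric])
  then show ?thesis
  proof (rule AE_mp, intro AE_I2 impI)
    fix \<omega> assume "eventually (\<lambda>j. \<omega> \<in> space M - miss p j) sequentially"
    then show "eventually (\<lambda>j. hit p j \<omega>) sequentially"
      using eventually_ge_at_top[of 1]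
      by eventually_elim (auto simp: miss_def miss_at_def hit_def)
  qed
qed

lemma powr_b: "real b powr x = 3 powr (real m * x)"
  by (simp add: b powr_powr[symmetric] powr_realpow)

lemma infinite_fst: "infinite (fst ` S) \<Longrightarrow> infinite S"
  by auto

text \<open>In every late generation some point shares the first \<open>level p j\<close> digits of
  \<open>\<xi>\<close>, which suffices for \<open>v < 0\<close> once \<open>1 / p < - v\<close>. The
  supremum of these \<open>v\<close> is 0.\<close>

lemma hit_imp_vbullet_nonneg:
  assumes hit: "\<And>p. p \<ge> 1 \<Longrightarrow> eventually (\<lambda>j. hit p j \<omega>) sequentially" and "\<xi> \<in> cantorK"
  shows "0 \<le> vbullet b Y \<omega> \<xi>"
proof -
  obtain a where a: "\<xi> = frac (cval a)" using assms(2) by (auto simp: cantorK_eq)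
  have mem: "\<xi> \<in> Fb b Y \<omega> v" if v: "v < 0" for v
  proof -
    obtain p where "1 / real (Suc p) < - v" using v nat_approx_posE[of "- v"] by auto
    then obtain p where p: "p \<ge> 1" "1 / real p < - v" by (metis Suc_le_mono le0 One_nat_def)
    then obtain J where J: "\<And>j. j \<ge> J \<Longrightarrow> hit p j \<omega>"
      using hit[of p] unfolding eventually_sequentially by auto
    let ?S = "{(j, k). j \<ge> 1 \<and> k \<in> Kset b j \<and> tdist \<xi> (Y (j, k) \<omega>) < real b powr (- (v + 1) * real j)}"
    have "{max J 1..} \<subseteq> fst ` ?S"
    proof
      fix j assume "j \<in> {max J 1..}"
      then have j: "j \<ge> J" "j \<ge> 1" by auto
      have "cpre a (level p j) \<in> cwords (level p j)" by (simp add: cwords_def)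
      then obtain k where k: "k \<in> KsetK b j" "Y (j, k) \<omega> \<in> cyl (level p j) (cpre a (level p j))"
        using J[OF j(1)] unfolding hit_def by blast
      from k(2) obtain a' where a': "\<And>i. i < level p j \<Longrightarrow> a' i = a i" "Y (j, k) \<omega> = frac (cval a')"
        by (rule mem_cyl_cpre) blast
      have "tdist \<xi> (Y (j, k) \<omega>) \<le> \<bar>cval a - cval a'\<bar>"
        unfolding a a' tdist_frac by (rule tdist_le_abs)
      also have "\<dots> \<le> 1 / 3 ^ level p j" by (intro cval_agree) (simp add: a')
      also have "\<dots> = 3 powr (- real (level p j))" by (simp add: powr_minus powr_realpow field_simps)
      also have "\<dots> < 3 powr (real m * (- (v + 1) * real j))"
      proof (intro powr_less_mono)
        have "real (m * j) * (1 + v) < real (m * j) * (1 - 1 / real p)"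
          using p j m by (intro mult_strict_left_mono) auto
        also have "\<dots> \<le> real (level p j)" by (rule level_ge)
        finally show "- real (level p j) < real m * (- (v + 1) * real j)" by (simp add: algebra_simps)
      qed auto
      finally have "tdist \<xi> (Y (j, k) \<omega>) < real b powr (- (v + 1) * real j)" by (simp only: powr_b)
      then have "(j, k) \<in> ?S" using j k KsetK_subset by auto
      then show "j \<in> fst ` ?S" by force
    qed
    then have "infinite (fst ` ?S)" using infinite_Ici infinite_super by blast
    then have "infinite ?S" by (rule infinite_fst)
    then show ?thesis by (simp add: Fb_def a torus_def frac_lt_1)
  qed
  show ?thesis
  proof (rule ccontr)
    assume "\<not> ?thesis"
    then have "vbullet b Y \<omega> \<xi> < 0" by simp
    then obtain v where v: "vbullet b Y \<omega> \<xi> < ereal v" "ereal v < 0"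
      using ereal_dense2 by blast
    then have "v < 0" by simp
    moreover have "ereal v \<le> vbullet b Y \<omega> \<xi>"
      unfolding vbullet_def by (rule Sup_upper) (use mem[OF \<open>v < 0\<close>] in auto)
    ultimately show False using v(1) by simp
  qed
qed

end

section \<open>Upper bound for the dimension\<close>

lemma summable_powr_neg: "c < 0 \<Longrightarrow> summable (\<lambda>j. 3 powr (c * real j) :: real)"
proof -
  assume "c < 0"
  then have "3 powr c < (1::real)" using powr_less_mono[of c 0 "3::real"] by simp
  then have "summable (\<lambda>j. (3 powr c :: real) ^ j)" by (intro summable_geometric) simp
  then show ?thesis by (simp add: powr_powr[symmetric] powr_realpow)
qed

lemma tdiam_le_ball:
  assumes "0 \<le> r" "\<And>\<xi>. \<xi> \<in> U \<Longrightarrow> tdist \<xi> y < r"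
  shows "tdiam U \<le> 2 * r"
proof (rule tdiam_le)
  fix \<xi> \<eta> assume "\<xi> \<in> U" "\<eta> \<in> U"
  then show "tdist \<xi> \<eta> \<le> 2 * r"
    using tdist_triangle[of \<xi> \<eta> y] assms(2)[of \<xi>] assms(2)[of \<eta>] by (simp add: tdist_commute[of y])
qed (use assms in auto)

lemma Fb_antimono:
  assumes "v \<le> v'" "b \<ge> 1"
  shows "Fb b Y \<omega> v' \<subseteq> Fb b Y \<omega> v"
proof -
  have "real b powr (- (v' + 1) * real j) \<le> real b powr (- (v + 1) * real j)" for j
    using assms by (intro powr_mono mult_right_mono) auto
  then have "{(j, k). j \<ge> 1 \<and> k \<in> Kset b j \<and> tdist \<xi> (Y (j, k) \<omega>) < real b powr (- (v' + 1) * real j)}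
    \<subseteq> {(j, k). j \<ge> 1 \<and> k \<in> Kset b j \<and> tdist \<xi> (Y (j, k) \<omega>) < real b powr (- (v + 1) * real j)}" for \<xi>
    by (auto intro: less_le_trans)
  then show ?thesis unfolding Fb_def by (auto dest: infinite_super)
qed

text \<open>The supremum may fail to be attained, but some admissible exponent exceeds
  \<open>v\<close>, and \<open>Fb\<close> decreases in its exponent.\<close>

lemma Vbullet_subset_Fb:
  assumes "v < v'" "b \<ge> 1"
  shows "Vbullet b Y \<omega> v' \<subseteq> Fb b Y \<omega> v"
proof
  fix \<xi> assume "\<xi> \<in> Vbullet b Y \<omega> v'"
  then have "ereal v' \<le> vbullet b Y \<omega> \<xi>" by (simp add: Vbullet_def)
  with assms have "ereal v < Sup {ereal u | u. \<xi> \<in> Fb b Y \<omega> u}"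
    unfolding vbullet_def by (meson ereal_less_eq(3) less_le_trans less_ereal.simps(1))
  then obtain u where "v < u" "\<xi> \<in> Fb b Y \<omega> u" unfolding less_Sup_iff by auto
  then show "\<xi> \<in> Fb b Y \<omega> v" using Fb_antimono[of v u b Y \<omega>] assms by (auto simp: subset_iff)
qed

context cantor_points
begin

text \<open>First moment argument: the covering sum has finite expectation, so it is almost surely
  finite and Hausdorff-Cantelli applies. The last two conditions on \<open>s\<close> control the
  Cantor points and the Lebesgue points respectively.\<close>

lemma AE_hausdorff_Fb_eq_0:
  assumes v: "- 1 < v" and s: "0 < s" "kappa < s * (v + 1)" "1 < (v + 1) * (1 - kappa + s)"
  shows "AE \<omega> in M. hausdorff s (Fb b Y \<omega> v \<inter> cantorK) = 0"
proof -
  define r where "r j = real b powr (- (v + 1) * real j)" for j :: nat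
  have r_eq: "r j = 3 powr (- (v + 1) * real (m * j))" for j
    by (simp add: r_def powr_b mult_ac)
  have r: "0 < r j" "r j \<le> 1" for j
  proof -
    have "3 powr (- (v + 1) * real (m * j)) \<le> 3 powr 0"
      using v by (intro powr_mono) (auto simp: mult_le_0_iff)
    then show "r j \<le> 1" by (simp add: r_eq)
  qed (simp add: r_eq)
  have "\<exists>B. B \<in> sets borel \<and> (\<forall>\<xi> y. \<xi> \<in> cantorK \<longrightarrow> tdist \<xi> y < r j \<longrightarrow> y \<in> B) \<and>
      emeasure torus_lebesgue B \<le> ennreal (36 * r j powr (1 - kappa))" for j
    using cantorK_neighbourhood[OF r[of j]] by metis
  then obtain B where B: "\<And>j. B j \<in> sets borel" "\<And>j \<xi> y. \<xi> \<in> cantorK \<Longrightarrow> tdist \<xi> y < r j \<Longrightarrow> y \<in> B j"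
      "\<And>j. emeasure torus_lebesgue (B j) \<le> ennreal (36 * r j powr (1 - kappa))"
    by metis
  \<comment> \<open>Balls around Cantor points always count; a ball around a Lebesgue point counts
    if its centre lies in \<open>B j\<close>, as it does whenever the ball meets the Cantor set.
    \<open>e\<close> bounds the expectation of \<open>X\<close>.\<close>
  define X where "X \<omega> x = (case x of (j, k) \<Rightarrow> if j \<ge> 1 \<and> k \<in> Kset b j
      then ennreal ((2 * r j) powr s) * (if k \<in> KsetK b j then 1 else indicator (Y (j, k) -` B j \<inter> space M) \<omega>)
      else 0)" for \<omega> x
  define e where "e x = (case x of (j, k) \<Rightarrow> if j \<ge> 1 \<and> k \<in> Kset b j
      then ennreal ((2 * r j) powr s) * (if k \<in> KsetK b j then 1 else ennreal (36 * r j powr (1 - kappa)))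
      else 0)" for x
  have sets_YB: "Y (j, k) -` B j \<inter> space M \<in> sets M" if "j \<ge> 1" "k \<in> Kset b j" for j k
    using that by (intro measurable_sets[OF measurable_Y B(1)])
  have X_meas: "(\<lambda>\<omega>. X \<omega> x) \<in> borel_measurable M" for x
  proof (cases x)
    case (Pair j k)
    show ?thesis
    proof (cases "j \<ge> 1 \<and> k \<in> Kset b j")
      case True
      then have [measurable]: "Y (j, k) -` B j \<inter> space M \<in> sets M" using sets_YB by simp
      show ?thesis using True by (cases "k \<in> KsetK b j") (simp_all add: Pair X_def)
    next
      case False
      then have "(\<lambda>\<omega>. X \<omega> x) = (\<lambda>_. 0)" unfolding X_def Pair by (auto simp del: One_nat_def)
      then show ?thesis by (simp only: borel_measurable_const)
    qed
  qed
  have X_int: "(\<integral>\<^sup>+\<omega>. X \<omega> x \<partial>M) \<le> e x" for x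
  proof (cases x)
    case (Pair j k)
    show ?thesis
    proof (cases "j \<ge> 1 \<and> k \<in> Kset b j")
      case True
      have "emeasure M (Y (j, k) -` B j \<inter> space M) \<le> ennreal (36 * r j powr (1 - kappa))" if "k \<notin> KsetK b j"
      proof -
        have "emeasure M (Y (j, k) -` B j \<inter> space M) = emeasure torus_lebesgue (B j)"
          using True that by (subst distr_Kset[of j k, symmetric]) (auto simp: emeasure_distr[OF measurable_Y B(1)])
        then show ?thesis using B(3)[of j] by simp
      qed
      then have "(\<integral>\<^sup>+\<omega>. indicator (Y (j, k) -` B j \<inter> space M) \<omega> \<partial>M) \<le> ennreal (36 * r j powr (1 - kappa))"
        if "k \<notin> KsetK b j"
        using True sets_YB[of j k] that by simp
      then show ?thesis
        using True sets_YB[of j k]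
        by (cases "k \<in> KsetK b j") (simp_all add: Pair X_def e_def nn_integral_cmult emeasure_space_1 mult_left_mono)
    qed (auto simp: Pair X_def e_def)
  qed
  \<comment> \<open>At most \<open>2 * 2 ^ (m * j)\<close> Cantor points, and at most
    \<open>3 ^ (m * j)\<close> others weighted by the probability of \<open>B j\<close>. Both series
    are geometric with negative exponents by the conditions on \<open>s\<close>.\<close>
  define g where "g j = 2 * 2 powr s * 3 powr (real m * (kappa - s * (v + 1)) * real j)
      + 36 * 2 powr s * 3 powr (real m * (1 - (v + 1) * (1 - kappa + s)) * real j)" for j :: nat
  have e_sum: "(\<Sum>k. e (j, k)) \<le> ennreal (g j)" for j
  proof (cases "j \<ge> 1")
    case True
    let ?c = "(2 * r j) powr s" and ?d = "36 * r j powr (1 - kappa)"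
    have "(\<Sum>k. e (j, k)) = (\<Sum>k\<in>Kset b j. e (j, k))"
      by (intro suminf_finite finite_Kset) (auto simp: e_def)
    also have "\<dots> = (\<Sum>k\<in>Kset b j. ennreal (?c * (if k \<in> KsetK b j then 1 else ?d)))"
      using True by (intro sum.cong) (auto simp: e_def ennreal_mult'')
    also have "\<dots> = ennreal (\<Sum>k\<in>Kset b j. ?c * (if k \<in> KsetK b j then 1 else ?d))"
      by (intro sum_ennreal) auto
    also have "\<dots> \<le> ennreal (g j)"
    proof (intro ennreal_leI)
      have "(\<Sum>k\<in>Kset b j. ?c * (if k \<in> KsetK b j then 1 else ?d))
          \<le> (\<Sum>k\<in>Kset b j. ?c * ((if k \<in> KsetK b j then 1 else 0) + ?d))"
        by (intro sum_mono mult_left_mono) auto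
      also have "\<dots> = ?c * (real (card (KsetK b j)) + real (card (Kset b j)) * ?d)"
        using KsetK_subset[of b j]
        by (simp add: sum_distrib_left[symmetric] sum.distrib finite_Kset sum.If_cases Int_absorb1)
      also have "\<dots> \<le> ?c * (2 * 2 ^ (m * j) + 3 ^ (m * j) * ?d)"
      proof (intro mult_left_mono add_mono mult_right_mono)
        have "real (card (KsetK b j)) \<le> real (2 * 2 ^ (m * j))"
          unfolding b by (intro of_nat_mono card_KsetK_le)
        then show "real (card (KsetK b j)) \<le> 2 * 2 ^ (m * j)" by simp
        have "real (card (Kset b j)) \<le> real (b ^ j)" by (intro of_nat_mono card_Kset_le)
        then show "real (card (Kset b j)) \<le> 3 ^ (m * j)" by (simp add: b power_mult)
      qed auto
      also have "\<dots> = g j"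
      proof -
        have c: "?c = 2 powr s * 3 powr (- (v + 1) * real (m * j) * s)"
          by (simp add: powr_mult r_eq powr_powr)
        have d: "?d = 36 * 3 powr (- (v + 1) * real (m * j) * (1 - kappa))"
          by (simp add: r_eq powr_powr)
        have two: "(2::real) ^ (m * j) = 3 powr (kappa * real (m * j))"
          by (simp only: powr_kappa powr_powr[symmetric]) (simp add: powr_realpow del: of_nat_mult)
        have three: "(3::real) ^ (m * j) = 3 powr real (m * j)"
          by (simp add: powr_realpow del: of_nat_mult)
        have "?c * (2 * 2 ^ (m * j) + 3 ^ (m * j) * ?d)
          = 2 * 2 powr s * 3 powr (- (v + 1) * real (m * j) * s + kappa * real (m * j))
          + 36 * 2 powr s * 3 powr (- (v + 1) * real (m * j) * s + real (m * j) + - (v + 1) * real (m * j) * (1 - kappa))"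
          unfolding c d two three powr_add by (simp add: algebra_simps)
        also have "\<dots> = g j" unfolding g_def by (simp add: algebra_simps)
        finally show ?thesis .
      qed
      finally show "(\<Sum>k\<in>Kset b j. ?c * (if k \<in> KsetK b j then 1 else ?d)) \<le> g j" .
    qed
    finally show ?thesis .
  qed (simp add: e_def)
  have "summable g"
    unfolding g_def using s m by (intro summable_add summable_mult summable_powr_neg) (auto simp: mult_less_0_iff)
  moreover have "0 \<le> g j" for j by (simp add: g_def)
  ultimately have g: "(\<Sum>j. ennreal (g j)) \<noteq> top" by (simp add: suminf_ennreal2)
  have "(\<integral>\<^sup>+\<omega>. (\<Sum>i. X \<omega> (prod_decode i)) \<partial>M) = (\<Sum>i. \<integral>\<^sup>+\<omega>. X \<omega> (prod_decode i) \<partial>M)"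
    by (intro nn_integral_suminf X_meas)
  also have "\<dots> \<le> (\<Sum>i. e (prod_decode i))" by (intro suminf_le X_int) auto
  also have "\<dots> = (\<Sum>j. \<Sum>k. e (j, k))" by (rule suminf_ennreal_2dimen) simp
  also have "\<dots> \<le> (\<Sum>j. ennreal (g j))" by (intro suminf_le e_sum) auto
  finally have "(\<integral>\<^sup>+\<omega>. (\<Sum>i. X \<omega> (prod_decode i)) \<partial>M) \<noteq> \<infinity>" using g by (auto simp: top_unique)
  then have "AE \<omega> in M. (\<Sum>i. X \<omega> (prod_decode i)) \<noteq> \<infinity>"
    using X_meas by (intro nn_integral_PInf_AE) measurable
  then show ?thesis
  proof (rule AE_mp, intro AE_I2 impI)
    fix \<omega> assume \<omega>: "\<omega> \<in> space M" "(\<Sum>i. X \<omega> (prod_decode i)) \<noteq> \<infinity>"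
    \<comment> \<open>Empty unless the ball meets the Cantor set, which justifies the indicator in
      \<open>X\<close>.\<close>
    define U where "U x = {\<xi> \<in> cantorK. fst x \<ge> 1 \<and> snd x \<in> Kset b (fst x) \<and> tdist \<xi> (Y x \<omega>) < r (fst x)}" for x
    have le: "ennreal (tdiam (U x) powr s) \<le> X \<omega> x" for x
    proof (cases "U x = {}")
      case True then show ?thesis using s by (simp add: tdiam_def)
    next
      case False
      obtain j k where x: "x = (j, k)" by (cases x)
      from False obtain \<xi> where \<xi>: "\<xi> \<in> cantorK" "j \<ge> 1" "k \<in> Kset b j" "tdist \<xi> (Y (j, k) \<omega>) < r j"
        unfolding U_def x by auto
      have "tdiam (U x) \<le> 2 * r j" using r[of j] by (intro tdiam_le_ball[of _ _ "Y x \<omega>"]) (auto simp: U_def x)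
      then have "tdiam (U x) powr s \<le> (2 * r j) powr s" using s by (intro powr_mono2 tdiam_nonneg) auto
      moreover have "X \<omega> x = ennreal ((2 * r j) powr s)"
        using \<xi> \<omega>(1) B(2)[OF \<xi>(1,4)] by (simp add: X_def x)
      ultimately show ?thesis by (simp add: ennreal_leI)
    qed
    show "hausdorff s (Fb b Y \<omega> v \<inter> cantorK) = 0"
    proof (rule hausdorff_limsup_eq_0[OF s(1)])
      have "(\<Sum>i. ennreal (tdiam (U (prod_decode i)) powr s)) \<le> (\<Sum>i. X \<omega> (prod_decode i))"
        by (intro suminf_le le) auto
      then have "(\<Sum>i. ennreal (tdiam (U (prod_decode i)) powr s)) \<noteq> top" using \<omega>(2) by (auto simp: top_unique)
      then show "summable (\<lambda>i. tdiam (U (prod_decode i)) powr s)" by (intro summable_suminf_not_top) auto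
      fix \<xi> assume \<xi>: "\<xi> \<in> Fb b Y \<omega> v \<inter> cantorK"
      let ?S = "{(j, k). j \<ge> 1 \<and> k \<in> Kset b j \<and> tdist \<xi> (Y (j, k) \<omega>) < real b powr (- (v + 1) * real j)}"
      have "infinite (prod_encode ` ?S)"
        using \<xi> by (auto simp: Fb_def finite_image_iff inj_prod_encode)
      moreover have "prod_encode ` ?S \<subseteq> {i. \<xi> \<in> U (prod_decode i)}"
        using \<xi> by (auto simp: U_def r_def)
      ultimately show "infinite {i. \<xi> \<in> U (prod_decode i)}" by (rule infinite_super[rotated])
    qed
  qed
qed

text \<open>Rational parameters give a single null set; monotonicity in both parameters then reaches
  all real \<open>v\<close> and \<open>s\<close>.\<close>

lemma AE_hausdorff_Vbullet_eq_0:
  "AE \<omega> in M. \<forall>v s. 0 \<le> v \<longrightarrow> kappa / (v + 1) < s \<longrightarrow> hausdorff s (Vbullet b Y \<omega> v \<inter> cantorK) = 0"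
proof -
  have "AE \<omega> in M. \<forall>q q'. - 1 < real_of_rat q \<longrightarrow> 0 < real_of_rat q' \<longrightarrow> kappa < of_rat q' * (of_rat q + 1) \<longrightarrow>
      1 < (of_rat q + 1) * (1 - kappa + of_rat q') \<longrightarrow> hausdorff (of_rat q') (Fb b Y \<omega> (of_rat q) \<inter> cantorK) = 0"
    unfolding AE_all_countable by (intro allI AE_impI AE_hausdorff_Fb_eq_0)
  then show ?thesis
  proof (rule AE_mp, intro AE_I2 impI allI)
    fix \<omega> v s assume *: "\<forall>q q'. - 1 < real_of_rat q \<longrightarrow> 0 < real_of_rat q' \<longrightarrow> kappa < of_rat q' * (of_rat q + 1) \<longrightarrow>
      1 < (of_rat q + 1) * (1 - kappa + of_rat q') \<longrightarrow> hausdorff (of_rat q') (Fb b Y \<omega> (of_rat q) \<inter> cantorK) = 0"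
      and v: "(0::real) \<le> v" and s: "kappa / (v + 1) < s"
    obtain q' where q': "kappa / (v + 1) < real_of_rat q'" "real_of_rat q' < s" using of_rat_dense[OF s] by auto
    have pos: "0 < real_of_rat q'" using q'(1) v kappa_pos by (meson add_nonneg_pos divide_pos_pos less_trans zero_less_one)
    have k: "kappa < of_rat q' * (v + 1)" using q'(1) v by (simp add: pos_divide_less_eq)
    \<comment> \<open>As \<open>(v + 1) * (1 - kappa + q') = 1 + v * (1 - kappa) + (q' * (v + 1) -
      kappa)\<close>, the first condition implies the second when \<open>v \<ge> 0\<close>.\<close>
    have "0 \<le> v * (1 - kappa)" using v kappa_less_1 by simp
    with k have "1 < (v + 1) * (1 - kappa + of_rat q')" by (simp add: algebra_simps)
    moreover have "0 < 1 - kappa + of_rat q'" using pos kappa_less_1 by linarith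
    ultimately have "1 / (1 - kappa + of_rat q') - 1 < v"
      by (simp add: pos_divide_less_eq diff_less_eq)
    moreover have "kappa / of_rat q' - 1 < v" using k pos by (simp add: field_simps)
    \<comment> \<open>The conditions are strict lower bounds that hold at \<open>v\<close>, so they
      hold at some rational \<open>q < v\<close>.\<close>
    ultimately have "max (- 1) (max (kappa / of_rat q' - 1) (1 / (1 - kappa + of_rat q') - 1)) < v" using v by simp
    then obtain q where q: "max (- 1) (max (kappa / of_rat q' - 1) (1 / (1 - kappa + of_rat q') - 1)) < real_of_rat q"
        "real_of_rat q < v" using of_rat_dense by blast
    have "kappa < of_rat q' * (of_rat q + 1)" using q pos by (simp add: field_simps)
    moreover have "1 < (of_rat q + 1) * (1 - kappa + of_rat q')" using q pos kappa_less_1 by (simp add: field_simps)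
    ultimately have zero: "hausdorff (of_rat q') (Fb b Y \<omega> (of_rat q) \<inter> cantorK) = 0" using * q pos by simp
    have "hausdorff s (Vbullet b Y \<omega> v \<inter> cantorK) \<le> hausdorff (of_rat q') (Vbullet b Y \<omega> v \<inter> cantorK)"
      using pos q' by (intro hausdorff_antimono) auto
    also have "\<dots> \<le> hausdorff (of_rat q') (Fb b Y \<omega> (of_rat q) \<inter> cantorK)"
      using q Vbullet_subset_Fb[of "of_rat q" v b Y \<omega>] b by (intro hausdorff_mono) auto
    finally show "hausdorff s (Vbullet b Y \<omega> v \<inter> cantorK) = 0" using zero by simp
  qed
qed

end

section \<open>Lower bound for the dimension\<close>

text \<open>The worst \<open>t\<close> is the end \<open>G (Suc i)\<close> of a forced block, where
  \<open>dens\<close> applies; inside a free block the count grows with slope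
  \<open>1 \<ge> \<alpha>\<close>. The loss of 1 is due to position 0, which lies before
  \<open>G 0\<close>.\<close>

lemma free_density:
  fixes G l :: "nat \<Rightarrow> nat" and \<alpha> :: real
  assumes "0 < \<alpha>" "\<alpha> \<le> 1" "G 0 = 1" and Gl: "\<And>i. G i \<le> l i" and lG: "\<And>i. l i < G (Suc i)"
    and dens: "\<And>i. \<alpha> * real (G (Suc i)) \<le> real (l i) - real (G i)"
  shows "\<alpha> * real t - 1 \<le> real (card ((\<Union>i. {G i..<l i}) \<inter> {..<t}))"
proof (cases "t = 0")
  case False
  let ?S = "(\<Union>i. {G i..<l i}) \<inter> {..<t}"
  have "G i < G (Suc i)" for i using Gl[of i] lG[of i] by simp
  then have G: "strict_mono G" by (rule strict_mono_Suc_iff[THEN iffD2, rule_format])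
  have "\<exists>i. t < G (Suc i)" using seq_suble[OF G] by (metis Suc_le_lessD)
  \<comment> \<open>By minimality \<open>t\<close> lies between \<open>G i\<close> and
    \<open>G (Suc i)\<close>; block \<open>i\<close> and its predecessor already contain enough free
    positions.\<close>
  then obtain i where i: "t < G (Suc i)" "\<And>k. k < i \<Longrightarrow> \<not> t < G (Suc k)"
    using exists_least_iff[of "\<lambda>i. t < G (Suc i)"] by auto
  have Gi: "G i \<le> t" using i(2)[of "i - 1"] False assms(3) by (cases i) auto
  have card_ge: "card A \<le> card ?S" if "A \<subseteq> ?S" for A
    by (rule card_mono[OF _ that]) (rule finite_Int, simp)
  show ?thesis
  proof (cases "l i < t")
    case True
    have "{G i..<l i} \<subseteq> ?S" using True by auto
    then have "l i - G i \<le> card ?S" using card_ge[of "{G i..<l i}"] by simp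
    then have "real (l i) - real (G i) \<le> real (card ?S)" using Gl[of i] by linarith
    moreover have "\<alpha> * real t \<le> \<alpha> * real (G (Suc i))" using i assms(1) by simp
    ultimately show ?thesis using dens[of i] by linarith
  next
    case t: False
    show ?thesis
    proof (cases i)
      case 0
      have "{1..<t} \<subseteq> {G 0..<l 0} \<inter> {..<t}" using t 0 assms(3) by auto
      also have "\<dots> \<subseteq> ?S" by blast
      finally have "{1..<t} \<subseteq> ?S" .
      then have "t - 1 \<le> card ?S" using card_ge[of "{1..<t}"] by simp
      moreover have "\<alpha> * real t \<le> real t" using assms by (simp add: mult_left_le_one_le)
      ultimately show ?thesis by linarith
    next
      case (Suc k)
      have "{G k..<l k} \<union> {G i..<t} \<subseteq> ({G k..<l k} \<union> {G i..<l i}) \<inter> {..<t}"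
        using t Suc lG[of k] Gi by auto
      also have "\<dots> \<subseteq> ?S" by blast
      finally have "{G k..<l k} \<union> {G i..<t} \<subseteq> ?S" .
      then have "card ({G k..<l k} \<union> {G i..<t}) \<le> card ?S" by (rule card_ge)
      moreover have "card ({G k..<l k} \<union> {G i..<t}) = (l k - G k) + (t - G i)"
        using lG[of k] Suc by (subst card_Un_disjoint) auto
      ultimately have "real (l k) - real (G k) + (real t - real (G i)) \<le> real (card ?S)"
        using Gl[of k] Gi by linarith
      moreover have "\<alpha> * (real t - real (G i)) \<le> real t - real (G i)"
        using assms Gi by (intro mult_left_le_one_le) auto
      ultimately show ?thesis using dens[of k] Suc by (simp add: right_diff_distrib)
    qed
  qed
qed simp

text \<open>
  The digits in \<open>S\<close> are free, the others are determined by the preceding digits through \<open>\<phi>\<close>.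
  Reading off the free digits only is a Hoelder map onto the whole Cantor set, which takes the
  place of a mass distribution. Digit 0 is prescribed so that the set lies in \<open>[0, 1/3]\<close>, where
  the distance on the circle is the usual one.
\<close>

lemma hausdorff_free_digits:
  fixes S :: "nat set" and \<phi> :: "nat \<Rightarrow> (nat \<Rightarrow> bool) \<Rightarrow> bool"
  assumes K: "hausdorff kappa cantorK \<noteq> 0" and \<alpha>: "0 < \<alpha>" "\<alpha> \<le> 1" and "0 \<notin> S"
    and free: "\<And>t. \<alpha> * real t - 1 \<le> real (card (S \<inter> {..<t}))"
    and causal: "\<And>t a a'. (\<And>i. i < t \<Longrightarrow> a i = a' i) \<Longrightarrow> \<phi> t a = \<phi> t a'"
    and \<phi>0: "\<And>a. \<not> \<phi> 0 a"
  shows "hausdorff (\<alpha> * kappa) (cval ` {a. \<forall>t. t \<notin> S \<longrightarrow> a t = \<phi> t a}) \<noteq> 0"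
proof -
  define E where "E = {a. \<forall>t. t \<notin> S \<longrightarrow> a t = \<phi> t a}"
  have inf: "infinite S"
  proof
    assume "finite S"
    obtain t :: nat where "real (card S) + 1 < real t * \<alpha>" using ex_less_of_nat_mult[OF \<alpha>(1)] by blast
    moreover have "real (card (S \<inter> {..<t})) \<le> real (card S)" using \<open>finite S\<close> by (intro of_nat_mono card_mono) auto
    ultimately show False using free[of t] by (simp add: mult.commute)
  qed
  define e where "e = enumerate S"
  have e: "strict_mono e" "range e = S"
    using inf by (simp_all add: e_def strict_mono_enumerate range_enumerate)
  have e_less: "e i < t" if "i < card (S \<inter> {..<t})" for i t
  proof (rule ccontr)
    assume "\<not> e i < t"
    then have "t \<le> e i" by simp
    have "S \<inter> {..<t} \<subseteq> e ` {..<i}"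
    proof
      fix x assume x: "x \<in> S \<inter> {..<t}"
      then obtain k where "x = e k" using e(2) by auto
      moreover from this have "e k < e i" using x \<open>t \<le> e i\<close> by simp
      ultimately show "x \<in> e ` {..<i}" using strict_mono_less[OF e(1)] by auto
    qed
    then have "card (S \<inter> {..<t}) \<le> card (e ` {..<i})" by (intro card_mono) auto
    also have "\<dots> \<le> i" using card_image_le[of "{..<i}" e] by simp
    finally show False using that by simp
  qed
  have card_e: "card (S \<inter> {..<e i}) = i" for i
  proof -
    have "S \<inter> {..<e i} = e ` {..<i}" using e by (auto simp: strict_mono_less)
    then show ?thesis using e(1) by (simp add: card_image strict_mono_imp_inj_on)
  qed
  define \<psi> where "\<psi> x = frac (cval (\<lambda>i. inv cval x (e i)))" for x
  have \<psi>: "\<psi> (cval a) = frac (cval (\<lambda>i. a (e i)))" for a by (simp add: \<psi>_def inv_f_f[OF inj_cval])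
  have "cantorK \<subseteq> \<psi> ` cval ` E"
  proof
    fix y assume "y \<in> cantorK"
    then obtain c where c: "y = frac (cval c)" by (auto simp: cantorK_eq)
    \<comment> \<open>The sequence with free digits \<open>c\<close> is built by recursion on the
      position; \<open>cut\<close> preserves the values below \<open>t\<close>, and by causality
      \<open>\<phi> t\<close> sees no others.\<close>
    define F where "F a t = (if t \<in> S then c (card (S \<inter> {..<t})) else \<phi> t a)" for a t
    define a where "a = wfrec less_than F"
    have "a t = F (cut a less_than t) t" for t
      unfolding a_def by (rule wfrec) simp
    moreover have "\<phi> t (cut a less_than t) = \<phi> t a" for t by (intro causal) (simp add: cut_def)
    ultimately have a: "a t = (if t \<in> S then c (card (S \<inter> {..<t})) else \<phi> t a)" for t by (simp add: F_def)
    then have "a \<in> E" unfolding E_def by simp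
    moreover have "a (e i) = c i" for i using a[of "e i"] card_e[of i] e(2) by auto
    then have "\<psi> (cval a) = y" by (simp add: \<psi> c)
    ultimately show "y \<in> \<psi> ` cval ` E" by blast
  qed
  then have "hausdorff kappa cantorK \<le> hausdorff kappa (\<psi> ` cval ` E)" by (rule hausdorff_mono)
  also have "\<dots> \<le> ennreal (9 powr kappa) * hausdorff (\<alpha> * kappa) (cval ` E)"
  proof (rule hausdorff_Hoelder_image[OF kappa_pos _ \<alpha>(1)])
    fix x y assume "x \<in> cval ` E" "y \<in> cval ` E"
    then obtain a a' where a: "a \<in> E" "a' \<in> E" "x = cval a" "y = cval a'" by auto
    show "tdist (\<psi> x) (\<psi> y) \<le> 9 * tdist x y powr \<alpha>"
    proof (cases "a = a'")
      case True then show ?thesis by (simp add: a tdist_def)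
    next
      case False
      then obtain t where t: "a t \<noteq> a' t" "\<And>i. i < t \<Longrightarrow> a i = a' i" by (rule first_difference[of a a']) auto
      have third: "0 \<le> cval a \<and> cval a \<le> 1 / 3" if "a \<in> E" for a
      proof -
        have "\<not> a 0" using that \<phi>0 \<open>0 \<notin> S\<close> by (auto simp: E_def)
        then show ?thesis using cval_Suc[of a] cval_nonneg[of a] cval_le_1[of "\<lambda>i. a (Suc i)"] by simp
      qed
      have "1 / 3 ^ Suc t \<le> \<bar>cval a - cval a'\<bar>" using t(2,1) by (rule cval_separated)
      also have "\<dots> = tdist x y" using third[OF a(1)] third[OF a(2)] unfolding a
        by (intro tdist_eq_abs[symmetric]) linarith
      finally have sep: "1 / 3 ^ Suc t \<le> tdist x y" .
      \<comment> \<open>\<open>t\<close> is the first difference, so \<open>a\<close> and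
        \<open>a'\<close> agree on the \<open>f\<close> free digits before it.\<close>
      define f where "f = card (S \<inter> {..<t})"
      have "tdist (\<psi> x) (\<psi> y) \<le> \<bar>cval (\<lambda>i. a (e i)) - cval (\<lambda>i. a' (e i))\<bar>"
        unfolding a \<psi> tdist_frac by (rule tdist_le_abs)
      also have "\<dots> \<le> 1 / 3 ^ f" by (intro cval_agree t(2) e_less) (simp add: f_def)
      also have "\<dots> = 3 powr (- real f)" by (simp add: powr_minus powr_realpow field_simps)
      \<comment> \<open>From \<open>f \<ge> \<alpha> * t - 1\<close> and
        \<open>\<alpha> \<le> 1\<close>; the 2 is the source of the constant 9.\<close>
      also have "\<dots> \<le> 3 powr (2 - \<alpha> * real (Suc t))"
        using free[of t] \<alpha> by (intro powr_mono) (auto simp: f_def algebra_simps)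
      also have "\<dots> = 9 * (1 / 3 ^ Suc t) powr \<alpha>"
      proof -
        have "(1 / 3 ^ Suc t) powr \<alpha> = 3 powr (- \<alpha> * real (Suc t))"
          by (simp add: powr_realpow[symmetric] powr_divide powr_powr powr_minus_divide mult.commute del: power_Suc of_nat_Suc powr_realpow)
        moreover have "3 powr (2 - \<alpha> * real (Suc t)) = 3 powr 2 * 3 powr (- \<alpha> * real (Suc t))"
          by (simp only: powr_add[symmetric]) simp
        ultimately show ?thesis by simp
      qed
      also have "\<dots> \<le> 9 * tdist x y powr \<alpha>" using sep \<alpha> by (intro mult_left_mono powr_mono2) auto
      finally show ?thesis .
    qed
  qed simp
  finally show ?thesis using K by (auto simp: E_def)
qed

context cantor_points
begin

text \<open>For a sparse generation with \<open>n = m * j\<close>, the free block ends near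
  \<open>n\<close> and the following forced block near \<open>(v + 1) * n\<close>. If generations
  grow fast, the proportion of free digits stays above \<open>\<alpha>\<close>.\<close>

lemma hit_imp_hausdorff_Vbullet:
  assumes hit: "\<And>p. p \<ge> 1 \<Longrightarrow> eventually (\<lambda>j. hit p j \<omega>) sequentially"
    and v: "0 \<le> v" and \<alpha>: "0 < \<alpha>" "\<alpha> * (v + 1) < 1"
  shows "hausdorff (\<alpha> * kappa) (Vbullet b Y \<omega> v \<inter> cantorK) \<noteq> 0"
proof -
  have \<alpha>1: "\<alpha> \<le> 1"
  proof -
    have "\<alpha> * 1 \<le> \<alpha> * (v + 1)" using v \<alpha> by (intro mult_left_mono) auto
    then show ?thesis using \<alpha> by linarith
  qed
  obtain p0 where p0: "1 / real (Suc p0) < 1 - \<alpha> * (v + 1)" using nat_approx_posE[of "1 - \<alpha> * (v + 1)"] \<alpha> by auto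
  define p where "p = Suc p0"
  \<comment> \<open>\<open>p\<close> is so large that a surplus \<open>\<delta>\<close> remains
    after the loss \<open>1 / p\<close> in the level.\<close>
  define \<delta> where "\<delta> = 1 - 1 / real p - \<alpha> * (v + 1)"
  have \<delta>: "0 < \<delta>" using p0 by (simp add: \<delta>_def p_def)
  obtain J where J: "\<And>j. j \<ge> J \<Longrightarrow> hit p j \<omega>"
    using hit[of p] unfolding eventually_sequentially by (auto simp: p_def)
  \<comment> \<open>Sharing \<open>h j\<close> digits with a point of generation \<open>j\<close>
    gives the strict inequality in \<open>Fb\<close>, hence the floor plus 1.\<close>
  define h where "h j = nat \<lfloor>real (m * j) * (v + 1)\<rfloor> + 1" for j
  have h: "real (m * j) * (v + 1) < real (h j)" "real (h j) \<le> real (m * j) * (v + 1) + 1" for j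
  proof -
    have "0 \<le> real (m * j) * (v + 1)" using v by simp
    then show "real (m * j) * (v + 1) < real (h j)" "real (h j) \<le> real (m * j) * (v + 1) + 1"
      unfolding h_def by linarith+
  qed
  \<comment> \<open>With \<open>n = m * j'\<close>, the level exceeds \<open>\<alpha> * h j'\<close>
    by at least \<open>\<delta> * n - \<alpha>\<close>, which absorbs any \<open>H\<close>.\<close>
  have ex: "\<exists>j'. j < j' \<and> J \<le> j' \<and> real H + \<alpha> * real (h j') \<le> real (level p j')" for j H
  proof -
    obtain N :: nat where N: "real H + 1 < real N * \<delta>" using ex_less_of_nat_mult[OF \<delta>] by blast
    define j' where "j' = Suc (j + J + N)"
    have "1 * N \<le> m * j'" unfolding j'_def using m by (intro mult_le_mono) auto
    then have "real N \<le> real (m * j')" unfolding of_nat_le_iff by simp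
    then have "real N * \<delta> \<le> real (m * j') * \<delta>" using \<delta> by (intro mult_right_mono) auto
    moreover have "\<alpha> * real (h j') \<le> \<alpha> * (real (m * j') * (v + 1) + 1)" using h(2)[of j'] \<alpha> by (intro mult_left_mono) auto
    moreover have "\<alpha> * (real (m * j') * (v + 1) + 1) = real (m * j') * (1 - 1 / real p) - real (m * j') * \<delta> + \<alpha>"
      by (simp add: \<delta>_def algebra_simps)
    ultimately have "real H + \<alpha> * real (h j') \<le> real (level p j')" using level_ge[of j' p] N \<alpha>1 by linarith
    then show ?thesis by (intro exI[of _ j']) (auto simp: j'_def)
  qed
  \<comment> \<open>The first clause provides the density condition for the initial block starting
    at 1, the second the one between consecutive generations.\<close>
  have "\<exists>js. \<forall>n. (J \<le> js n \<and> 1 \<le> js n \<and> 1 + \<alpha> * real (h (js n)) \<le> real (level p (js n))) \<and>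
      (js n < js (Suc n) \<and> real (h (js n)) + \<alpha> * real (h (js (Suc n))) \<le> real (level p (js (Suc n))))"
  proof (rule dependent_nat_choice)
    show "\<exists>j. J \<le> j \<and> 1 \<le> j \<and> 1 + \<alpha> * real (h j) \<le> real (level p j)" using ex[of 0 1] by auto
    fix j and n :: nat
    obtain j' where j': "j < j'" "J \<le> j'" "real (h j) + \<alpha> * real (h j') \<le> real (level p j')" using ex[of j "h j"] by auto
    have "1 \<le> h j" by (simp add: h_def)
    then have "1 + \<alpha> * real (h j') \<le> real (level p j')" using j' by linarith
    then show "\<exists>j'. (J \<le> j' \<and> 1 \<le> j' \<and> 1 + \<alpha> * real (h j') \<le> real (level p j')) \<and>
        (j < j' \<and> real (h j) + \<alpha> * real (h j') \<le> real (level p j'))" using j' by auto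
  qed
  then obtain js where js: "\<And>n. J \<le> js n" "\<And>n. 1 \<le> js n" "1 + \<alpha> * real (h (js 0)) \<le> real (level p (js 0))"
      "\<And>n. js n < js (Suc n)" "\<And>n. real (h (js n)) + \<alpha> * real (h (js (Suc n))) \<le> real (level p (js (Suc n)))"
    by blast
  \<comment> \<open>Positions in \<open>{G i..<l i}\<close> are free, those in
    \<open>{l i..<G (Suc i)}\<close> forced.\<close>
  define l where "l i = level p (js i)" for i
  define G where "G i = (case i of 0 \<Rightarrow> 1 | Suc i \<Rightarrow> h (js i))" for i
  have dens: "\<alpha> * real (G (Suc i)) \<le> real (l i) - real (G i)" for i
    using js(3) js(5)[of "i - 1"] by (cases i) (auto simp: l_def G_def)
  have Gl: "G i \<le> l i" for i
  proof -
    have "0 \<le> \<alpha> * real (G (Suc i))" using \<alpha> by simp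
    then show ?thesis using dens[of i] by linarith
  qed
  have lG: "l i < G (Suc i)" for i
  proof -
    have "real (l i) \<le> real (m * js i)" by (simp add: l_def level_def)
    also have "\<dots> \<le> real (m * js i) * (v + 1)" using v by (simp add: algebra_simps)
    also have "\<dots> < real (G (Suc i))" using h(1) by (simp add: G_def)
    finally show ?thesis by simp
  qed
  define S where "S = (\<Union>i. {G i..<l i})"
  have G_mono: "i \<le> k \<Longrightarrow> G i \<le> G k" and l_mono: "i \<le> k \<Longrightarrow> l i \<le> l k" for i k
    using Gl lG by (meson lift_Suc_mono_le less_imp_le order_trans)+
  have forced: "t \<notin> S" if "l i \<le> t" "t < G (Suc i)" for i t
  proof
    assume "t \<in> S"
    then obtain k where k: "G k \<le> t" "t < l k" by (auto simp: S_def)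
    show False
    proof (cases "k \<le> i")
      case True then show False using l_mono[OF True] k that by simp
    next
      case False then show False using G_mono[of "Suc i" k] k that by simp
    qed
  qed
  \<comment> \<open>Forced blocks are disjoint, so a forced position belongs to a single
    generation.\<close>
  have uniq: "i = k" if "l i \<le> t" "t < G (Suc i)" "l k \<le> t" "t < G (Suc k)" for i k t
  proof (rule ccontr)
    assume "i \<noteq> k"
    then consider "Suc i \<le> k" | "Suc k \<le> i" by linarith
    then show False using G_mono[of "Suc i" k] G_mono[of "Suc k" i] Gl[of i] Gl[of k] that by cases auto
  qed
  \<comment> \<open>All cylinders of level \<open>l i\<close> are hit: whatever the first
    \<open>l i\<close> digits, some random point extends them.\<close>
  have "\<exists>c. (\<forall>u<l i. c u = w u) \<and> (\<exists>k\<in>KsetK b (js i). Y (js i, k) \<omega> = frac (cval c))" for i w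
  proof -
    have "cpre w (l i) \<in> cwords (l i)" by (simp add: cwords_def)
    then obtain k where k: "k \<in> KsetK b (js i)" "Y (js i, k) \<omega> \<in> cyl (l i) (cpre w (l i))"
      using J[OF js(1)[of i]] unfolding hit_def l_def by blast
    from k(2) obtain c where "\<And>u. u < l i \<Longrightarrow> c u = w u" "Y (js i, k) \<omega> = frac (cval c)" by (rule mem_cyl_cpre) blast
    then show ?thesis using k(1) by blast
  qed
  then obtain C where C: "\<And>i w u. u < l i \<Longrightarrow> C i w u = w u"
      "\<And>i w. \<exists>k\<in>KsetK b (js i). Y (js i, k) \<omega> = frac (cval (C i w))"
    by metis
  \<comment> \<open>The digits in \<open>{l i..<G (Suc i)}\<close> are copied from a random point of generation \<open>js i\<close> that shares
      the first \<open>l i\<close> digits.\<close>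
  define \<phi> where "\<phi> t a \<longleftrightarrow> (\<exists>i. l i \<le> t \<and> t < G (Suc i) \<and> C i (\<lambda>u. u < l i \<and> a u) t)" for t a
  have "hausdorff (\<alpha> * kappa) (cval ` {a. \<forall>t. t \<notin> S \<longrightarrow> a t = \<phi> t a}) \<noteq> 0"
  proof (rule hausdorff_free_digits)
    show "hausdorff kappa cantorK \<noteq> 0" by (rule hausdorff_cantorK[OF prob_cantor])
    have G1: "1 \<le> G i" for i using G_mono[of 0 i] by (simp add: G_def)
    show "0 \<notin> S"
    proof
      assume "0 \<in> S"
      then obtain i where "G i \<le> 0" by (auto simp: S_def)
      then show False using G1[of i] by simp
    qed
    show "\<alpha> * real t - 1 \<le> real (card (S \<inter> {..<t}))" for t
      unfolding S_def by (rule free_density) (use \<alpha> \<alpha>1 Gl lG dens in \<open>auto simp: G_def\<close>)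
    show "\<phi> t a = \<phi> t a'" if "\<And>i. i < t \<Longrightarrow> a i = a' i" for t a a'
    proof -
      \<comment> \<open>\<open>C i\<close> is given only the digits below
        \<open>l i \<le> t\<close>; this makes \<open>\<phi>\<close> causal.\<close>
      have "(\<lambda>u. u < l i \<and> a u) = (\<lambda>u. u < l i \<and> a' u)" if "l i \<le> t" for i
        using that \<open>\<And>i. i < t \<Longrightarrow> a i = a' i\<close> by auto
      then show ?thesis unfolding \<phi>_def by metis
    qed
    show "\<not> \<phi> 0 a" for a using G1 Gl unfolding \<phi>_def by (metis le_zero_eq not_one_le_zero)
  qed (use \<alpha> \<alpha>1 in auto)
  moreover have "cval ` {a. \<forall>t. t \<notin> S \<longrightarrow> a t = \<phi> t a} \<subseteq> Vbullet b Y \<omega> v \<inter> cantorK"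
  proof
    fix x assume "x \<in> cval ` {a. \<forall>t. t \<notin> S \<longrightarrow> a t = \<phi> t a}"
    then obtain a where a: "x = cval a" "\<And>t. t \<notin> S \<Longrightarrow> a t = \<phi> t a" by auto
    \<comment> \<open>Below \<open>l i\<close> the random point repeats the digits of
      \<open>a\<close>; from \<open>l i\<close> on, \<open>a\<close> repeats those of the
      point.\<close>
    have agree: "a t = C i (\<lambda>u. u < l i \<and> a u) t" if t: "t < h (js i)" for i t
    proof (cases "t < l i")
      case False
      then have it: "l i \<le> t" "t < G (Suc i)" using t by (auto simp: G_def)
      then have "a t = \<phi> t a" by (intro a(2) forced)
      also have "\<dots> = C i (\<lambda>u. u < l i \<and> a u) t" unfolding \<phi>_def using it uniq by blast
      finally show ?thesis .
    qed (simp add: C(1))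
    \<comment> \<open>Then \<open>x \<le> 1 / 3\<close>, so reduction modulo 1 leaves
      \<open>x\<close> unchanged.\<close>
    have "\<not> a 0"
    proof -
      have "1 \<le> G i" for i using G_mono[of 0 i] by (simp add: G_def)
      then have "0 < G i" "0 < l i" for i using Gl[of i] by (auto simp: Suc_le_eq intro: less_le_trans)
      then have "0 \<notin> S" "\<not> \<phi> 0 a" by (auto simp: S_def \<phi>_def)
      then show ?thesis using a(2)[of 0] by simp
    qed
    then have x01: "0 \<le> x" "x < 1"
      using cval_Suc[of a] cval_nonneg[of a] cval_le_1[of "\<lambda>i. a (Suc i)"] by (simp_all add: a(1))
    then have "frac x = x" by (simp add: frac_eq)
    then have xK: "x \<in> cantorK" unfolding cantorK_eq a(1) by (metis rangeI)
    let ?S = "{(j, k). j \<ge> 1 \<and> k \<in> Kset b j \<and> tdist x (Y (j, k) \<omega>) < real b powr (- (v + 1) * real j)}"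
    have "range js \<subseteq> fst ` ?S"
    proof safe
      fix i
      obtain k where k: "k \<in> KsetK b (js i)" "Y (js i, k) \<omega> = frac (cval (C i (\<lambda>u. u < l i \<and> a u)))" using C(2) by blast
      have "tdist x (Y (js i, k) \<omega>) \<le> \<bar>cval a - cval (C i (\<lambda>u. u < l i \<and> a u))\<bar>"
        using tdist_le_abs by (metis k(2) a(1) tdist_frac \<open>frac x = x\<close>)
      also have "\<dots> \<le> 1 / 3 ^ h (js i)" by (intro cval_agree agree)
      also have "\<dots> = 3 powr (- real (h (js i)))" by (simp add: powr_minus powr_realpow field_simps)
      also have "\<dots> < 3 powr (real m * (- (v + 1) * real (js i)))"
        using h(1)[of "js i"] by (intro powr_less_mono) (auto simp: algebra_simps)
      finally have "tdist x (Y (js i, k) \<omega>) < real b powr (- (v + 1) * real (js i))" by (simp only: powr_b)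
      then have "(js i, k) \<in> ?S" using k js(2)[of i] KsetK_subset by auto
      then show "js i \<in> fst ` ?S" by force
    qed
    moreover have "infinite (range js)"
      using js(4) by (intro range_inj_infinite strict_mono_imp_inj_on) (simp add: strict_mono_Suc_iff)
    ultimately have "infinite (fst ` ?S)" by (rule infinite_super)
    then have "infinite ?S" by (rule infinite_fst)
    then have "x \<in> Fb b Y \<omega> v" using x01 by (simp add: Fb_def torus_def)
    then have "ereal v \<le> vbullet b Y \<omega> x" unfolding vbullet_def by (intro Sup_upper) auto
    then show "x \<in> Vbullet b Y \<omega> v \<inter> cantorK" using x01 xK by (simp add: Vbullet_def torus_def)
  qed
  then have "hausdorff (\<alpha> * kappa) (cval ` {a. \<forall>t. t \<notin> S \<longrightarrow> a t = \<phi> t a})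
      \<le> hausdorff (\<alpha> * kappa) (Vbullet b Y \<omega> v \<inter> cantorK)" by (rule hausdorff_mono)
  ultimately show ?thesis by auto
qed

lemma hdim_Vbullet:
  assumes hit: "\<And>p. p \<ge> 1 \<Longrightarrow> eventually (\<lambda>j. hit p j \<omega>) sequentially"
    and null: "\<And>s. kappa / (v + 1) < s \<Longrightarrow> hausdorff s (Vbullet b Y \<omega> v \<inter> cantorK) = 0"
    and v: "0 \<le> v"
  shows "hdim (Vbullet b Y \<omega> v \<inter> cantorK) = kappa / (v + 1)"
proof (rule antisym)
  have pos: "0 < kappa / (v + 1)" using v kappa_pos by simp
  show "hdim (Vbullet b Y \<omega> v \<inter> cantorK) \<le> kappa / (v + 1)"
    by (rule dense_ge) (use null pos in \<open>auto intro: hdim_le\<close>)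
  show "kappa / (v + 1) \<le> hdim (Vbullet b Y \<omega> v \<inter> cantorK)"
  proof (rule le_hdim)
    show "hausdorff (kappa / (v + 1) + 1) (Vbullet b Y \<omega> v \<inter> cantorK) = 0" by (rule null) simp
    show "0 \<le> kappa / (v + 1) + 1" using pos by simp
    fix r assume r: "0 \<le> r" "r < kappa / (v + 1)"
    \<comment> \<open>Any \<open>\<alpha>\<close> with \<open>r \<le> \<alpha> * kappa\<close> and
      \<open>\<alpha> * (v + 1) < 1\<close> would do; the second argument of \<open>max\<close>
      keeps it positive when \<open>r = 0\<close>.\<close>
    define \<alpha> where "\<alpha> = max (r / kappa) (1 / (2 * (v + 1)))"
    have "r / kappa * (v + 1) < 1" using r(2) v kappa_pos by (simp add: field_simps)
    moreover have "1 / (2 * (v + 1)) * (v + 1) < 1" using v by simp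
    ultimately have "\<alpha> * (v + 1) < 1" by (simp add: \<alpha>_def max_def)
    moreover have "0 < \<alpha>" using v by (simp add: \<alpha>_def less_max_iff_disj)
    ultimately have "hausdorff (\<alpha> * kappa) (Vbullet b Y \<omega> v \<inter> cantorK) \<noteq> 0"
      by (intro hit_imp_hausdorff_Vbullet hit v)
    moreover have "r \<le> \<alpha> * kappa"
      using kappa_pos by (simp add: pos_divide_le_eq[symmetric] \<alpha>_def)
    then have "hausdorff (\<alpha> * kappa) (Vbullet b Y \<omega> v \<inter> cantorK) \<le> hausdorff r (Vbullet b Y \<omega> v \<inter> cantorK)"
      using r(1) by (intro hausdorff_antimono)
    ultimately show "hausdorff r (Vbullet b Y \<omega> v \<inter> cantorK) \<noteq> 0" by auto
  qed
qed

end

theorem theorem2p7: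
  fixes M :: "'a measure" and Y :: "nat \<times> nat \<Rightarrow> 'a \<Rightarrow> real" and m b :: nat
  assumes "prob_space M"
    and "m \<ge> 1" and "b = 3 ^ m"
    and "prob_space.indep_vars M (\<lambda>_. borel) Y {(j, k). j \<ge> 1 \<and> k \<in> Kset b j}"
    and "\<forall>j k. j \<ge> 1 \<and> k \<in> KsetK b j \<longrightarrow> distr M borel (Y (j, k)) = cantor_measure"
    and "\<forall>j k. j \<ge> 1 \<and> k \<in> Kset b j - KsetK b j \<longrightarrow> distr M borel (Y (j, k)) = torus_lebesgue"
  shows "AE \<omega> in M. (\<forall>\<xi> \<in> cantorK. 0 \<le> vbullet b Y \<omega> \<xi>) \<and>
           (\<forall>v::real. v \<ge> 0 \<longrightarrow> hdim (Vbullet b Y \<omega> v \<inter> cantorK) = kappa / (v + 1))"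
proof -
  interpret cantor_points M Y m b
    using assms by (simp add: cantor_points_def cantor_points_axioms_def)
  \<comment> \<open>There are countably many \<open>p\<close>, so one null set serves all of
    them.\<close>
  have "AE \<omega> in M. \<forall>p. p \<ge> 1 \<longrightarrow> eventually (\<lambda>j. hit p j \<omega>) sequentially"
    unfolding AE_all_countable by (intro allI AE_impI AE_hit)
  with AE_hausdorff_Vbullet_eq_0 show ?thesis
    by eventually_elim (auto intro: hit_imp_vbullet_nonneg hdim_Vbullet)
qed

end
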